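(* Let $n\ge 0$ be an integer, let $0\le \alpha_0<\alpha_1<\cdots<\alpha_n$ be real numbers, and for each $j=0,1,\ldots,n$ let $X_j=(f_j,g_j):\mathbb{R}^2\to\mathbb{R}^2$ be a fixed continuous homogeneous vector field with degree of homogeneity $\alpha_j$. Consider the class of planar vector fields $$X(x,y)=(-y,x)+\sum_{j=0}^n a_j X_j(x,y),\qquad \mathbf{a}=(a_0,a_1,\ldots,a_n)\in\mathbb{R}^{n+1}.$$ For $j=0,1,\ldots,n$ set $$I_j=\int_0^{2\pi}\big(f_j(\cos\theta,\sin\theta)\cos\theta+g_j(\cos\theta,\sin\theta)\sin\theta\big)\,d\theta,$$ and let $m+1$ be the number of non-zero values among $I_0,I_1,\ldots,I_n$. Then there exist values of $\mathbf{a}\in\mathbb{R}^{n+1}$ such that the differential equation $(\dot x,\dot y)=X(x,y)$ has at least $m$ limit cycles. Moreover, if all the vector fields $X_j$, $j=0,1,\ldots,n$, are of class $\mathcal{C}^1$, the $m$ limit cycles so obtained are hyperbolic (that is, there exist values of $\mathbf{a}$ for which the differential equation has at least $m$ hyperbolic limit cycles).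
   Context: A continuous vector field $X:\mathbb{R}^2\to\mathbb{R}^2$ is called homogeneous with degree of homogeneity $\alpha$, where $0\le\alpha\in\mathbb{R}$, if $X(rx,ry)=r^{\alpha}X(x,y)$ for all $(x,y)\in\mathbb{R}^2$ and all real $r\ge 0$ (with $0^0=1$). The vector field $X=(f,g)$ has associated planar system $\dot x=f(x,y)$, $\dot y=g(x,y)$. A limit cycle of a planar system is a (non-constant) periodic orbit that is isolated in the set of all periodic orbits of the system. The vector fields $X_j$ are not assumed to be Lipschitz. *)

theory Defs
  imports "HOL-Analysis.Analysis"
begin

type_synonym vector_field = "real \<times> real \<Rightarrow> real \<times> real"

(* The case distinction implements 0^0 = 1; in the library 0 powr a = 0 for every a. *)
definition homogeneous :: "real \<Rightarrow> vector_field \<Rightarrow> bool" where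
  "homogeneous \<alpha> X \<longleftrightarrow> 0 \<le> \<alpha> \<and>
     (\<forall>r\<ge>0. \<forall>x y. X (r * x, r * y) = (if r = 0 \<and> \<alpha> = 0 then 1 else r powr \<alpha>) *\<^sub>R X (x, y))"

definition C1_field :: "vector_field \<Rightarrow> bool" where
  "C1_field X \<longleftrightarrow> (\<exists>X' :: real \<times> real \<Rightarrow> (real \<times> real) \<Rightarrow>\<^sub>L (real \<times> real).
     (\<forall>p. (X has_derivative blinfun_apply (X' p)) (at p)) \<and> continuous_on UNIV X')"

definition solution_on :: "vector_field \<Rightarrow> (real \<Rightarrow> real \<times> real) \<Rightarrow> real set \<Rightarrow> bool" where
  "solution_on X u S \<longleftrightarrow> (\<forall>t\<in>S. (u has_vector_derivative X (u t)) (at t within S))"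

(* Solutions through a point need not be unique, so an orbit is
   the image of a solution rather than the orbit of a point under a flow. *)
definition periodic_orbit :: "vector_field \<Rightarrow> (real \<times> real) set \<Rightarrow> bool" where
  "periodic_orbit X \<gamma> \<longleftrightarrow> (\<exists>u T. 0 < T \<and> solution_on X u UNIV \<and> (\<forall>t. u (t + T) = u t) \<and>
     (\<exists>t. u t \<noteq> u 0) \<and> \<gamma> = range u)"

(* Isolated: some neighbourhood of the orbit contains no other periodic orbit. *)
definition limit_cycle :: "vector_field \<Rightarrow> (real \<times> real) set \<Rightarrow> bool" where
  "limit_cycle X \<gamma> \<longleftrightarrow> periodic_orbit X \<gamma> \<and>
     (\<exists>U. open U \<and> \<gamma> \<subseteq> U \<and> (\<forall>\<gamma>'. periodic_orbit X \<gamma>' \<and> \<gamma>' \<subseteq> U \<longrightarrow> \<gamma>' = \<gamma>))"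

(* P is the Poincare map, near 0 and in the coordinate s, of the section s |-> p + s v at a point p
   of an orbit of period T: the continuous return time tau with tau 0 = T singles out the
   return to the section after one turn. *)
definition return_map ::
  "vector_field \<Rightarrow> real \<times> real \<Rightarrow> real \<times> real \<Rightarrow> real \<Rightarrow> (real \<Rightarrow> real) \<Rightarrow> bool" where
  "return_map X p v T P \<longleftrightarrow> (\<exists>\<delta>>0. \<exists>\<tau> \<phi>. continuous_on {-\<delta><..<\<delta>} \<tau> \<and> \<tau> 0 = T \<and>
     (\<forall>s\<in>{-\<delta><..<\<delta>}. 0 < \<tau> s \<and> solution_on X (\<phi> s) {0..\<tau> s} \<and>
        \<phi> s 0 = p + s *\<^sub>R v \<and> \<phi> s (\<tau> s) = p + P s *\<^sub>R v))"

(* Meant for C^1 fields. There the Poincare map is unique near 0, and its derivative D at 0, the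
   nontrivial characteristic multiplier, does not depend on the base point u 0 or on the
   transversal direction v, so the existential quantifiers are harmless. T is the least period. *)
definition hyperbolic_limit_cycle :: "vector_field \<Rightarrow> (real \<times> real) set \<Rightarrow> bool" where
  "hyperbolic_limit_cycle X \<gamma> \<longleftrightarrow> limit_cycle X \<gamma> \<and>
     (\<exists>u T v P D. 0 < T \<and> solution_on X u UNIV \<and> (\<forall>t. u (t + T) = u t) \<and>
        (\<forall>t. 0 < t \<and> t < T \<longrightarrow> u t \<noteq> u 0) \<and> \<gamma> = range u \<and>
        fst v * snd (X (u 0)) - snd v * fst (X (u 0)) \<noteq> 0 \<and>
        return_map X (u 0) v T P \<and> (P has_real_derivative D) (at 0) \<and> \<bar>D\<bar> \<noteq> 1)"

definition combined_field :: "nat \<Rightarrow> (nat \<Rightarrow> vector_field) \<Rightarrow> (nat \<Rightarrow> real) \<Rightarrow> vector_field" where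
  "combined_field n X a = (\<lambda>(x, y). (-y, x) + (\<Sum>j\<le>n. a j *\<^sub>R X j (x, y)))"

definition radial_integral :: "vector_field \<Rightarrow> real" where
  "radial_integral X = integral {0..2 * pi}
     (\<lambda>\<theta>. fst (X (cos \<theta>, sin \<theta>)) * cos \<theta> + snd (X (cos \<theta>, sin \<theta>)) * sin \<theta>)"

end

theory Submission
  imports Defs
begin

text \<open>Write \<open>(x, y) = exp r (cos \<theta>, sin \<theta>)\<close> and let \<open>F\<^sub>j\<close>, \<open>G\<^sub>j\<close> be the radial and the angular component of
\<open>X\<^sub>j\<close> on the unit circle, so that \<open>I\<^sub>j\<close> is the integral of \<open>F\<^sub>j\<close>. By homogeneity the field with
coefficients \<open>\<epsilon> c\<^sub>j\<close> becomes \<open>r' = \<epsilon> F(r, \<theta>)\<close>, \<open>\<theta>' = 1 + \<epsilon> G(r, \<theta>)\<close>, where \<open>F\<close> is the sum of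
\<open>c\<^sub>j exp ((\<alpha>\<^sub>j - 1) r) F\<^sub>j(\<theta>)\<close> and \<open>G\<close> that of \<open>c\<^sub>j exp ((\<alpha>\<^sub>j - 1) r) G\<^sub>j(\<theta>)\<close>. In \<open>\<theta>\<close> these functions
are only continuous, but in \<open>r\<close> they are smooth. Hence the equation \<open>dr/d\<theta> = \<epsilon> F / (1 + \<epsilon> G)\<close> of the orbits
that wind around the origin has unique solutions and a differentiable return map \<open>P\<close>, which takes the
value of \<open>r\<close> at \<open>\<theta> = 0\<close> to its value at \<open>\<theta> = 2 \<pi>\<close>.

Averaging over one turn gives \<open>P \<rho> = \<rho> + \<epsilon> q(\<rho>) + O(\<epsilon>\<^sup>2)\<close>, together with the derivative in \<open>\<rho>\<close>, where \<open>q\<close> is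
the sum of \<open>c\<^sub>j I\<^sub>j exp ((\<alpha>\<^sub>j - 1) \<rho>)\<close>. For small positive \<open>\<epsilon>\<close> every simple zero of \<open>q\<close> therefore has a
hyperbolic fixed point of \<open>P\<close> next to it (\<open>averaging\<close>), and such a fixed point is a hyperbolic limit cycle
of the planar field (\<open>hyperbolic_cycle\<close>).

The \<open>m + 1\<close> non-zero \<open>I\<^sub>j\<close> leave the coefficients of \<open>m + 1\<close> exponentials in \<open>q\<close> free. Linear algebra gives
a non-trivial choice for which \<open>q\<close> vanishes at \<open>m\<close> prescribed points
(\<open>nontrivial_combination_vanishing\<close>). By Rolle's theorem an exponential sum with \<open>m + 1\<close> terms has at most
\<open>m\<close> zeros counted with multiplicity, so these zeros are simple (\<open>exp_sum_simple_zeros\<close>). The resulting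
\<open>m\<close> cycles lie in disjoint annuli; since a hyperbolic limit cycle is in particular a limit cycle, they
prove both claims at once.

The equation for \<open>r\<close> is slow: its integral operator is a contraction over the whole turn. So one
application of the contraction principle yields the solution on the turn, and uniqueness and Lipschitz
dependence on the initial value come from the mean value theorem on the same interval.\<close>

section \<open>Elementary real analysis\<close>

text \<open>Gronwall's inequality in the form needed for uniqueness: \<open>w\<^sup>2 exp (- 2 K t)\<close> is non-increasing,
non-negative, and zero at the left end.\<close>
lemma zero_of_linear_growth:
  fixes w f :: "real \<Rightarrow> real"
  assumes w': "\<And>t. t \<in> {a..b} \<Longrightarrow> (w has_real_derivative f t) (at t within {a..b})"
    and bound: "\<And>t. t \<in> {a..b} \<Longrightarrow> \<bar>f t\<bar> \<le> K * \<bar>w t\<bar>"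
    and "w a = 0" and t: "t \<in> {a..b}"
  shows "w t = 0"
proof -
  define v where "v = (\<lambda>t. (w t)\<^sup>2 * exp (- 2 * K * t))"
  have v': "(v has_real_derivative (2 * w t * f t - 2 * K * (w t)\<^sup>2) * exp (- 2 * K * t)) (at t within {a..b})"
    if "t \<in> {a..b}" for t
    unfolding v_def
    by (rule derivative_eq_intros w'[OF that] refl)+ (simp add: algebra_simps power2_eq_square)
  have vc: "continuous_on {a..b} v" by (rule DERIV_continuous_on[OF v'])
  have "v t \<le> v a"
  proof (rule DERIV_nonpos_imp_decreasing_open[of a t v])
    show "a \<le> t" using t by simp
    show "continuous_on {a..t} v" using vc by (rule continuous_on_subset) (use t in auto)
    fix x assume x: "a < x" "x < t"
    have "w x * f x \<le> \<bar>w x\<bar> * \<bar>f x\<bar>" by (metis abs_ge_self abs_mult)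
    also have "\<dots> \<le> \<bar>w x\<bar> * (K * \<bar>w x\<bar>)" using bound[of x] x t by (intro mult_left_mono) auto
    also have "\<dots> = K * (w x)\<^sup>2" by (simp add: power2_eq_square)
    finally have "(2 * w x * f x - 2 * K * (w x)\<^sup>2) * exp (- 2 * K * x) \<le> 0"
      by (intro mult_nonpos_nonneg) auto
    moreover have "x \<in> interior {a..b}" using x t by auto
    ultimately show "\<exists>y. DERIV v x :> y \<and> y \<le> 0"
      using v'[of x] x t at_within_interior[of x "{a..b}"] by (intro exI conjI) auto
  qed
  then have "(w t)\<^sup>2 * exp (- 2 * K * t) \<le> 0" using assms(3) by (simp add: v_def)
  then show ?thesis by (auto simp: mult_le_0_iff)
qed

text \<open>If the values and the one-sided derivatives of a function agree at both ends of an interval, its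
periodic extension is differentiable also where two copies meet.\<close>
lemma periodic_extension_derivative:
  fixes f f' :: "real \<Rightarrow> real"
  assumes p: "0 < p"
    and f': "\<And>x. x \<in> {0..p} \<Longrightarrow> (f has_real_derivative f' x) (at x within {0..p})"
    and closes: "f p = f 0" "f' p = f' 0"
  defines "per \<equiv> \<lambda>x. x - p * of_int \<lfloor>x / p\<rfloor>"
  shows "((\<lambda>x. f (per x)) has_real_derivative f' (per x)) (at x)"
proof -
  have per: "per y \<in> {0..p}" for y
    using floor_divide_lower[OF p, of y] floor_divide_upper[OF p, of y]
    by (auto simp: per_def algebra_simps)
  have per_eq: "(y = p * of_int (k + 1) \<and> per y = 0) \<or> per y = y - p * of_int k"
    if "y \<in> {p * of_int k..p * of_int (k+1)}" for y and k :: int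
  proof (cases "y = p * of_int (k+1)")
    case True
    then show ?thesis using p by (simp add: per_def)
  next
    case False
    then have "\<lfloor>y / p\<rfloor> = k" using that p
      by (intro floor_unique) (auto simp: field_simps)
    then show ?thesis by (simp add: per_def)
  qed
  have on_turn: "((\<lambda>x. f (per x)) has_real_derivative f' (per x))
       (at x within {p * of_int k..p * of_int (k+1)})"
    if x: "x \<in> {p * of_int k..p * of_int (k+1)}" for k :: int
  proof -
    let ?J = "{p * of_int k..p * of_int (k+1)}"
    have turn_end: "y - p * of_int k = p" if "y = p * of_int (k + 1)" for y
      using that by (simp add: algebra_simps)
    have f_eq: "f (per y) = f (y - p * of_int k)" if "y \<in> ?J" for y
      using per_eq[OF that] turn_end[of y] by (elim disjE conjE) (simp_all only: closes)
    have f'_eq: "f' (per x) = f' (x - p * of_int k)"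
      using per_eq[OF x] turn_end[of x] by (elim disjE conjE) (simp_all only: closes)
    have img: "(\<lambda>y. y - p * of_int k) ` ?J \<subseteq> {0..p}" by (auto simp: algebra_simps)
    have "(f has_real_derivative f' (x - p * of_int k)) (at (x - p * of_int k) within (\<lambda>y. y - p * of_int k) ` ?J)"
      by (rule has_field_derivative_subset[OF f' img]) (use x in \<open>auto simp: algebra_simps\<close>)
    moreover have "((\<lambda>y. y - p * of_int k) has_real_derivative 1) (at x within ?J)"
      by (auto intro!: derivative_eq_intros)
    ultimately have "((\<lambda>y. f (y - p * of_int k)) has_real_derivative f' (x - p * of_int k)) (at x within ?J)"
      using DERIV_image_chain[of f _ "\<lambda>y. y - p * of_int k" x ?J 1] by (simp add: o_def)
    then show ?thesis unfolding f'_eq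
      by (rule has_field_derivative_transform_within[where d=1]) (use x f_eq in auto)
  qed
  define k where "k = \<lfloor>x / p\<rfloor>"
  have k: "p * of_int k \<le> x" "x < p * of_int (k + 1)"
    using floor_divide_lower[OF p, of x] floor_divide_upper[OF p, of x]
    by (auto simp: k_def algebra_simps)
  show ?thesis
  proof (cases "x = p * of_int k")
    case False
    have int: "x \<in> interior {p * of_int k..p * of_int (k+1)}"
      unfolding interior_atLeastAtMost_real using k False by simp
    show ?thesis using on_turn[of k] k unfolding at_within_interior[OF int] by simp
  next
    case True
    let ?J1 = "{p * of_int (k - 1)..p * of_int (k - 1 + 1)}" and ?J2 = "{p * of_int k..p * of_int (k+1)}"
    have "((\<lambda>x. f (per x)) has_real_derivative f' (per x)) (at x within ?J1 \<union> ?J2)"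
      unfolding has_field_derivative_iff
    proof (intro Lim_Un)
      show "((\<lambda>y. (f (per y) - f (per x)) / (y - x)) \<longlongrightarrow> f' (per x)) (at x within ?J1)"
        using on_turn[of "k - 1"] True p unfolding has_field_derivative_iff by (simp add: right_diff_distrib)
      show "((\<lambda>y. (f (per y) - f (per x)) / (y - x)) \<longlongrightarrow> f' (per x)) (at x within ?J2)"
        using on_turn[of k] True p unfolding has_field_derivative_iff by (simp add: distrib_left)
    qed
    moreover have "?J1 \<union> ?J2 = {p * of_int (k - 1)..p * of_int (k+1)}"
      using p by (simp add: ivl_disj_un_two_touch right_diff_distrib distrib_left)
    moreover have int: "x \<in> interior {p * of_int (k - 1)..p * of_int (k+1)}"
      unfolding interior_atLeastAtMost_real using True p by (simp add: right_diff_distrib distrib_left)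
    ultimately show ?thesis by (simp only: at_within_interior[OF int])
  qed
qed

lemma antiderivative_real:
  fixes f :: "real \<Rightarrow> 'a::euclidean_space"
  assumes "continuous_on UNIV f"
  shows "\<exists>F. \<forall>x. (F has_vector_derivative f x) (at x)"
  using einterval_antiderivative[of "-\<infinity>" "\<infinity>" f] assms
  by (auto simp: continuous_on_eq_continuous_at)

text \<open>The equation \<open>\<theta>' = h(\<theta>)\<close> is solved by inverting the time function \<open>H\<close>, a primitive of \<open>1 / h\<close>. The bounds
on \<open>h\<close> make \<open>H\<close> a bijection of the line.\<close>
lemma autonomous_solution:
  fixes h :: "real \<Rightarrow> real"
  assumes h: "continuous_on UNIV h" and a: "0 < a" and ah: "\<And>x. a \<le> h x" and hb: "\<And>x. h x \<le> b"
  obtains \<theta> H :: "real \<Rightarrow> real" where "\<And>t. (\<theta> has_real_derivative h (\<theta> t)) (at t)"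
    "\<And>x. (H has_real_derivative 1 / h x) (at x)" "\<theta> 0 = 0" "H 0 = 0"
    "\<And>x. \<theta> (H x) = x" "\<And>t. H (\<theta> t) = t" "strict_mono H" "strict_mono \<theta>"
proof -
  have pos: "h x > 0" for x using a ah[of x] by linarith
  have b: "b > 0" using pos[of 0] hb[of 0] by linarith
  have "continuous_on UNIV (\<lambda>x. 1 / h x)"
    using pos by (intro continuous_intros h) (metis less_irrefl)
  from antiderivative_real[OF this] obtain F where F: "\<And>x. (F has_vector_derivative 1 / h x) (at x)" by blast
  define H where "H x = F x - F 0" for x
  have H': "(H has_real_derivative 1 / h x) (at x)" for x
    using F[of x] unfolding H_def has_real_derivative_iff_has_vector_derivative[symmetric]
    by (auto intro!: derivative_eq_intros)
  have H0: "H 0 = 0" by (simp add: H_def)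
  have Hc: "continuous_on A H" for A
    by (rule DERIV_continuous_on[OF has_field_derivative_at_within[OF H']])
  have mono: "strict_mono H"
    by (rule strict_monoI, rule DERIV_pos_imp_increasing) (use H' pos in \<open>auto intro!: exI\<close>)
  have grow: "H y - H x \<ge> (y - x) / b" if "x \<le> y" for x y
  proof -
    have "H x - x / b \<le> H y - y / b"
    proof (rule DERIV_nonneg_imp_nondecreasing[OF that])
      fix z 
      have "((\<lambda>x. H x - x / b) has_real_derivative 1 / h z - 1 / b) (at z)"
        using b by (auto intro!: derivative_eq_intros H')
      moreover have "0 \<le> 1 / h z - 1 / b" using hb[of z] pos[of z] b by (simp add: field_simps)
      ultimately show "\<exists>y. ((\<lambda>x. H x - x / b) has_real_derivative y) (at z) \<and> 0 \<le> y" by blast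
    qed
    then show ?thesis by (simp add: diff_divide_distrib)
  qed
  have surj: "\<exists>x. H x = t" for t
  proof -
    have 1: "H (-(\<bar>t\<bar> * b)) \<le> t" using grow[of "-(\<bar>t\<bar> * b)" 0] b H0 by simp
    have 2: "t \<le> H (\<bar>t\<bar> * b)" using grow[of 0 "\<bar>t\<bar> * b"] b H0 by simp
    have "-(\<bar>t\<bar> * b) \<le> \<bar>t\<bar> * b" using b by (smt (verit) abs_ge_zero mult_nonneg_nonneg)
    from IVT'[OF 1 2 this Hc] show ?thesis by blast
  qed
  have inj: "inj H" using mono by (rule strict_mono_imp_inj_on)
  define \<theta> where "\<theta> = inv H"
  have \<theta>H: "\<theta> (H x) = x" for x using inj by (simp add: \<theta>_def)
  have H\<theta>: "H (\<theta> t) = t" for t using surj by (metis \<theta>H)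
  have "(\<theta> has_real_derivative h (\<theta> t)) (at t)" for t
    unfolding has_field_derivative_def
  proof (rule has_derivative_inverse_strong_x[of UNIV \<theta> t H])
    show "(H has_derivative (*) (1 / h (\<theta> t))) (at (\<theta> t))"
      using H' by (simp add: has_field_derivative_def)
    show "(*) (1 / h (\<theta> t)) \<circ> (*) (h (\<theta> t)) = id" using pos[of "\<theta> t"] by (auto simp: fun_eq_iff)
  qed (use Hc H\<theta> \<theta>H in auto)
  moreover have "strict_mono \<theta>" 
    by (rule strict_monoI) (metis H\<theta> mono strict_mono_less)
  moreover have "\<theta> 0 = 0" using \<theta>H[of 0] H0 by simp
  ultimately show ?thesis using that H' H0 \<theta>H H\<theta> mono by blast
qed

section \<open>Logarithmic polar coordinates\<close>

text \<open>The complex exponential in real coordinates. The logarithm of the radius is used as a coordinate because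
powers of the radius become exponentials and no positivity has to be tracked.\<close>
definition pol :: "real \<Rightarrow> real \<Rightarrow> real \<times> real" where
  "pol r x = (exp r * cos x, exp r * sin x)"

lemma pol_derivative:
  assumes "(r has_real_derivative r') (at t within A)" "(x has_real_derivative x') (at t within A)"
  shows "((\<lambda>t. pol (r t) (x t)) has_vector_derivative
     (exp (r t) * (r' * cos (x t) - x' * sin (x t)), exp (r t) * (r' * sin (x t) + x' * cos (x t)))) (at t within A)"
proof -
  have "((\<lambda>t. exp (r t) * cos (x t)) has_vector_derivative exp (r t) * (r' * cos (x t) - x' * sin (x t))) (at t within A)"
    "((\<lambda>t. exp (r t) * sin (x t)) has_vector_derivative exp (r t) * (r' * sin (x t) + x' * cos (x t))) (at t within A)"
    unfolding has_real_derivative_iff_has_vector_derivative[symmetric]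
    by (rule derivative_eq_intros assms refl | simp add: algebra_simps)+
  then show ?thesis unfolding pol_def by (rule has_vector_derivative_Pair)
qed

lemma norm_pol [simp]: "norm (pol r x) = exp r"
proof -
  have "(exp r * cos x)\<^sup>2 + (exp r * sin x)\<^sup>2 = (exp r)\<^sup>2 * ((cos x)\<^sup>2 + (sin x)\<^sup>2)"
    by (simp add: algebra_simps power_mult_distrib del: sin_cos_squared_add sin_cos_squared_add2)
  then show ?thesis by (simp add: pol_def norm_Pair)
qed

lemma pol_eq_iff: "pol r x = pol s y \<longleftrightarrow> r = s \<and> (\<exists>k::int. x = y + 2 * pi * of_int k)"
proof
  assume eq: "pol r x = pol s y"
  then have "exp r = exp s" by (metis norm_pol)
  then have "r = s" by simp
  moreover have "sin x = sin y \<and> cos x = cos y" using eq \<open>r = s\<close> by (simp add: pol_def)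
  ultimately show "r = s \<and> (\<exists>k::int. x = y + 2 * pi * of_int k)"
    by (auto simp: sin_cos_eq_iff)
next
  assume "r = s \<and> (\<exists>k::int. x = y + 2 * pi * of_int k)"
  then show "pol r x = pol s y" 
    by (auto simp: pol_def sin_add cos_add mult.assoc[symmetric])
qed

text \<open>In complex notation a primitive \<open>g\<close> of the logarithmic derivative \<open>z' / z\<close> satisfies \<open>(z exp (- g))' = 0\<close>, so
with the right constant \<open>z = exp g\<close>; the lift consists of the real and the imaginary part of \<open>g\<close>.\<close>
lemma polar_lift:
  fixes u u' :: "real \<Rightarrow> real \<times> real"
  assumes u: "\<And>t. (u has_vector_derivative u' t) (at t)" and u': "continuous_on UNIV u'"
    and nz: "\<And>t. u t \<noteq> 0"
  obtains r x r' x' :: "real \<Rightarrow> real" where "\<And>t. u t = pol (r t) (x t)"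
    "\<And>t. (r has_real_derivative r' t) (at t)" "\<And>t. (x has_real_derivative x' t) (at t)"
proof -
  define z where "z t = Complex (fst (u t)) (snd (u t))" for t
  define z' where "z' t = Complex (fst (u' t)) (snd (u' t))" for t
  have z: "(z has_vector_derivative z' t) (at t)" for t
    unfolding z_def z'_def has_vector_derivative_complex_iff has_real_derivative_iff_has_vector_derivative
    using bounded_linear.has_vector_derivative[OF bounded_linear_fst u[of t]]
      bounded_linear.has_vector_derivative[OF bounded_linear_snd u[of t]] by simp
  have znz: "z t \<noteq> 0" for t using nz[of t] by (auto simp: z_def complex_eq_iff prod_eq_iff)
  have zc: "continuous_on UNIV z" by (rule continuous_on_vector_derivative[OF has_vector_derivative_at_within[OF z]])
  have z'c: "continuous_on UNIV z'" unfolding z'_def Complex_eq by (intro continuous_intros u')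
  have "continuous_on UNIV (\<lambda>t. z' t / z t)" using znz by (intro continuous_intros zc z'c) auto
  from antiderivative_real[OF this] obtain G where G: "\<And>t. (G has_vector_derivative z' t / z t) (at t)" by blast
  define g where "g t = G t - G 0 + Ln (z 0)" for t
  have g: "(g has_vector_derivative z' t / z t) (at t)" for t
    unfolding g_def using G[of t] by (auto intro!: derivative_eq_intros)
  define q where "q t = z t * exp (- g t)" for t
  have "(q has_vector_derivative 0) (at t)" for t
  proof -
    have "((\<lambda>w. exp (- w)) has_field_derivative - exp (- g t)) (at (g t))"
      by (auto intro!: derivative_eq_intros)
    from field_vector_diff_chain_at[OF g this]
    have "((\<lambda>t. exp (- g t)) has_vector_derivative z' t / z t * - exp (- g t)) (at t)"
      by (simp add: o_def)
    from has_vector_derivative_mult[OF z this] show ?thesis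
      using znz[of t] by (simp add: q_def[abs_def])
  qed
  then obtain c where c: "\<And>t. q t = c"
    using has_vector_derivative_zero_constant[of UNIV q] by auto
  have "q 0 = 1" using znz[of 0] by (simp add: q_def g_def exp_minus)
  then have "q t = 1" for t by (simp only: c)
  then have "z t = exp (g t)" for t by (simp add: q_def exp_minus field_simps)
  then have "Complex (fst (u t)) (snd (u t)) = exp (g t)" for t by (simp only: z_def)
  then have "u t = pol (Re (g t)) (Im (g t))" for t
    by (auto simp: pol_def prod_eq_iff complex_eq_iff Re_exp Im_exp)
  moreover have "((\<lambda>t. Re (g t)) has_real_derivative Re (z' t / z t)) (at t)"
    "((\<lambda>t. Im (g t)) has_real_derivative Im (z' t / z t)) (at t)" for t
    using g[of t] by (simp_all add: has_vector_derivative_complex_iff)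
  ultimately show ?thesis
    by (rule that[of "\<lambda>t. Re (g t)" "\<lambda>t. Im (g t)" "\<lambda>t. Re (z' t / z t)" "\<lambda>t. Im (z' t / z t)"])
qed

section \<open>A slow scalar equation over one turn\<close>

definition slow_solution :: "(real \<Rightarrow> real \<Rightarrow> real) \<Rightarrow> (real \<Rightarrow> real) \<Rightarrow> bool" where
  "slow_solution S u \<longleftrightarrow>
     (\<forall>x\<in>{0..2*pi}. (u has_real_derivative S (u x) x) (at x within {0..2*pi}))"

text \<open>The bound on the Lipschitz constant makes the integral operator of the equation a contraction, with
factor \<open>1/4\<close>, on functions on the full turn \<open>[0, 2 \<pi>]\<close>.\<close>
locale slow_flow =
  fixes S :: "real \<Rightarrow> real \<Rightarrow> real" and L M :: real
  assumes S_cont: "continuous_on UNIV (\<lambda>p. S (fst p) (snd p))"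
    and S_bdd: "\<And>r x. \<bar>S r x\<bar> \<le> M"
    and S_lip: "\<And>r s x. \<bar>S r x - S s x\<bar> \<le> L * \<bar>r - s\<bar>"
    and S_slow: "2 * pi * L \<le> 1/4"
begin

lemma L_nonneg: "0 \<le> L"
  using S_lip[of 1 0 0] by simp

lemma S_cont_comp:
  assumes "continuous_on A f" "continuous_on A g"
  shows "continuous_on A (\<lambda>x. S (f x) (g x))"
  using continuous_on_compose2[OF S_cont continuous_on_Pair[OF assms]] by simp

text \<open>Picard's theorem, as the Banach fixed point of the integral operator on bounded continuous functions. To
work with functions on the whole line, the upper limit of integration is clamped to \<open>[0, 2 \<pi>]\<close>.\<close>
lemma solution_exists: "\<exists>u. u 0 = \<rho> \<and> slow_solution S u"
proof -
  define cl where "cl x = max 0 (min (2*pi) x)" for x :: real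
  have cl: "cl x \<in> {0..2*pi}" for x by (auto simp: cl_def)
  have clid: "cl x = x" if "x \<in> {0..2*pi}" for x using that by (auto simp: cl_def)
  define I where "I u x = integral {0..x} (\<lambda>s. S (apply_bcontfun u s) s)" for u x
  have cSu: "continuous_on A (\<lambda>s. S (apply_bcontfun u s) s)" for u A
    by (intro S_cont_comp continuous_on_apply_bcontfun continuous_on_id)
  have Ibound: "\<bar>I u x\<bar> \<le> M * (2*pi)" if "x \<in> {0..2*pi}" for u x
  proof -
    have "norm (I u x) \<le> M * (x - 0)"
      unfolding I_def using that by (intro integral_bound cSu) (auto simp: S_bdd)
    also have "\<dots> \<le> M * (2*pi)" using that S_bdd[of 0 0]
      by (intro mult_left_mono) auto
    finally show ?thesis by simp
  qed
  define \<Phi> where "\<Phi> u = Bcontfun (\<lambda>x. \<rho> + I u (cl x))" for u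
  have Ider: "(I u has_real_derivative S (apply_bcontfun u x) x) (at x within {0..2*pi})"
    if "x \<in> {0..2*pi}" for u x
    unfolding I_def by (rule integral_has_real_derivative[OF cSu that])
  have Icont: "continuous_on {0..2*pi} (I u)" for u
    by (rule DERIV_continuous_on[OF Ider])
  have cclc: "continuous_on UNIV cl" unfolding cl_def by (intro continuous_intros)
  have inb: "(\<lambda>x. \<rho> + I u (cl x)) \<in> bcontfun" for u
  proof (rule bcontfun_normI)
    show "continuous_on UNIV (\<lambda>x. \<rho> + I u (cl x))"
      by (rule continuous_on_add[OF continuous_on_const continuous_on_compose2[OF Icont cclc]])
        (use cl in auto)
    show "norm (\<rho> + I u (cl x)) \<le> \<bar>\<rho>\<bar> + M * (2*pi)" for x
      using Ibound[OF cl, of u x] abs_triangle_ineq[of \<rho> "I u (cl x)"] unfolding real_norm_def by linarith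
  qed
  have app: "apply_bcontfun (\<Phi> u) x = \<rho> + I u (cl x)" for u x
    unfolding \<Phi>_def by (simp add: Bcontfun_inverse[OF inb])
  have contr: "dist (\<Phi> u) (\<Phi> v) \<le> (1/4) * dist u v" for u v
  proof (rule dist_bound)
    fix x
    let ?y = "cl x"
    have "I u ?y - I v ?y = integral {0..?y} (\<lambda>s. S (apply_bcontfun u s) s - S (apply_bcontfun v s) s)"
      unfolding I_def by (subst integral_diff) (auto intro!: integrable_continuous_interval cSu)
    also have "norm \<dots> \<le> (L * dist u v) * (?y - 0)"
    proof (rule integral_bound)
      show "0 \<le> ?y" using cl[of x] by simp
      show "continuous_on {0..?y} (\<lambda>s. S (apply_bcontfun u s) s - S (apply_bcontfun v s) s)"
        by (intro continuous_intros cSu)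
      fix s
      have "norm (S (apply_bcontfun u s) s - S (apply_bcontfun v s) s) \<le> L * \<bar>apply_bcontfun u s - apply_bcontfun v s\<bar>"
        using S_lip by simp
      also have "\<dots> \<le> L * dist u v"
        using dist_bounded[of u s v] L_nonneg by (intro mult_left_mono) (auto simp: dist_real_def)
      finally show "norm (S (apply_bcontfun u s) s - S (apply_bcontfun v s) s) \<le> L * dist u v" .
    qed
    also have "\<dots> \<le> (L * dist u v) * (2*pi)"
      using cl[of x] L_nonneg by (intro mult_left_mono) auto
    also have "\<dots> = (2 * pi * L) * dist u v" by simp
    also have "\<dots> \<le> (1/4) * dist u v"
      by (rule mult_right_mono[OF S_slow]) simp
    finally show "dist (apply_bcontfun (\<Phi> u) x) (apply_bcontfun (\<Phi> v) x) \<le> (1/4) * dist u v"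
      by (simp add: app dist_real_def)
  qed
  have "\<exists>!u. \<Phi> u = u"
    by (rule banach_fix_type[where c="1/4"]) (use contr in auto)
  then obtain u where u: "\<Phi> u = u" by auto
  let ?u = "apply_bcontfun u"
  have eq: "?u x = \<rho> + I u x" if "x \<in> {0..2*pi}" for x
    using app[of u x] by (simp only: u clid[OF that])
  have "slow_solution S ?u"
    unfolding slow_solution_def
  proof
    fix x :: real assume x: "x \<in> {0..2*pi}"
    have "((\<lambda>x. \<rho> + I u x) has_real_derivative S (?u x) x) (at x within {0..2*pi})"
      using DERIV_add[OF DERIV_const Ider[OF x, of u]] by simp
    then show "(?u has_real_derivative S (?u x) x) (at x within {0..2*pi})"
      by (rule has_field_derivative_transform_within[where d=1]) (use x eq in auto)
  qed
  moreover have "?u 0 = \<rho>" using eq[of 0] by (simp add: I_def)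
  ultimately show ?thesis by blast
qed

lemma solution_continuous: "slow_solution S u \<Longrightarrow> continuous_on {0..2*pi} u"
  unfolding slow_solution_def by (rule DERIV_continuous_on) blast

text \<open>At the point where the distance \<open>W\<close> of the two solutions is largest, the mean value theorem gives
\<open>W \<le> \<bar>u 0 - v 0\<bar> + W / 4\<close>.\<close>
lemma solutions_stay_close:
  assumes u: "slow_solution S u" and v: "slow_solution S v" and x: "x \<in> {0..2*pi}"
  shows "\<bar>u x - v x\<bar> \<le> 2 * \<bar>u 0 - v 0\<bar>"
proof -
  define w where "w = (\<lambda>x. u x - v x)"
  have "continuous_on {0..2*pi} (\<lambda>x. \<bar>w x\<bar>)"
    unfolding w_def by (intro continuous_intros solution_continuous u v)
  then obtain x0 where x0: "x0 \<in> {0..2*pi}" "\<And>y. y \<in> {0..2*pi} \<Longrightarrow> \<bar>w y\<bar> \<le> \<bar>w x0\<bar>"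
    using continuous_attains_sup[of "{0..2*pi}" "\<lambda>x. \<bar>w x\<bar>"] by auto
  have "norm (w x0 - w 0) \<le> (L * \<bar>w x0\<bar>) * norm (x0 - 0)"
  proof (rule field_differentiable_bound)
    show "convex {0..2*pi}" by simp
    fix z assume z: "z \<in> {0..2*pi}"
    show "(w has_real_derivative (S (u z) z - S (v z) z)) (at z within {0..2*pi})"
      unfolding w_def using u v z by (auto simp: slow_solution_def intro!: DERIV_diff)
    have "\<bar>S (u z) z - S (v z) z\<bar> \<le> L * \<bar>w z\<bar>" using S_lip by (simp add: w_def)
    also have "\<dots> \<le> L * \<bar>w x0\<bar>" using x0(2)[OF z] L_nonneg by (intro mult_left_mono)
    finally show "norm (S (u z) z - S (v z) z) \<le> L * \<bar>w x0\<bar>" by simp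
  qed (use x0 in auto)
  also have "\<dots> \<le> (L * \<bar>w x0\<bar>) * (2*pi)"
    using x0 L_nonneg by (intro mult_left_mono) auto
  also have "\<dots> = (2 * pi * L) * \<bar>w x0\<bar>" by simp
  also have "\<dots> \<le> (1/4) * \<bar>w x0\<bar>" by (rule mult_right_mono[OF S_slow]) simp
  finally have "\<bar>w x0 - w 0\<bar> \<le> (1/4) * \<bar>w x0\<bar>" by simp
  then have "\<bar>w x0\<bar> \<le> 2 * \<bar>w 0\<bar>" by linarith
  then show ?thesis using x0(2)[OF x] by (simp add: w_def)
qed

definition flow :: "real \<Rightarrow> real \<Rightarrow> real" where
  "flow \<rho> = (SOME u. u 0 = \<rho> \<and> slow_solution S u)"

lemma flow_0 [simp]: "flow \<rho> 0 = \<rho>" and flow_solution: "slow_solution S (flow \<rho>)"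
  using someI_ex[OF solution_exists[of \<rho>]] by (auto simp: flow_def)

lemma flow_deriv:
  "x \<in> {0..2*pi} \<Longrightarrow> (flow \<rho> has_real_derivative S (flow \<rho> x) x) (at x within {0..2*pi})"
  using flow_solution by (simp add: slow_solution_def)

lemma flow_continuous: "continuous_on {0..2*pi} (flow \<rho>)"
  by (rule solution_continuous[OF flow_solution])

lemma flow_lipschitz:
  "x \<in> {0..2*pi} \<Longrightarrow> \<bar>flow \<rho> x - flow \<sigma> x\<bar> \<le> 2 * \<bar>\<rho> - \<sigma>\<bar>"
  using solutions_stay_close[OF flow_solution flow_solution, of x \<rho> \<sigma>] by simp

lemma flow_near_start:
  assumes x: "x \<in> {0..2*pi}"
  shows "\<bar>flow \<rho> x - \<rho>\<bar> \<le> 2 * pi * M"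
proof -
  have "norm (flow \<rho> x - flow \<rho> 0) \<le> M * norm (x - 0)"
    by (rule field_differentiable_bound[of "{0..2*pi}" _ "\<lambda>x. S (flow \<rho> x) x"]) (use x S_bdd flow_deriv in auto)
  also have "\<dots> \<le> M * (2*pi)"
    using x S_bdd[of 0 0] by (intro mult_left_mono) auto
  finally show ?thesis by (simp add: mult_ac)
qed

lemma flow_jointly_continuous:
  "continuous_on (UNIV \<times> {0..2*pi}) (\<lambda>p. flow (fst p) (snd p))"
  unfolding continuous_on_iff
proof (intro ballI allI impI)
  fix p :: "real \<times> real" and e :: real
  assume "p \<in> UNIV \<times> {0..2*pi}" and e: "0 < e"
  then obtain \<rho> x where p: "p = (\<rho>, x)" and x: "x \<in> {0..2*pi}" by (cases p) auto
  obtain d where d: "d > 0" "\<And>y. y \<in> {0..2*pi} \<Longrightarrow> dist y x < d \<Longrightarrow> dist (flow \<rho> y) (flow \<rho> x) < e/2"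
    using flow_continuous[of \<rho>] x e unfolding continuous_on_iff by (metis half_gt_zero)
  have "dist (flow (fst q) (snd q)) (flow \<rho> x) < e"
    if q: "q \<in> UNIV \<times> {0..2*pi}" "dist q p < min d (e/4)" for q
  proof -
    have 1: "dist (fst q) \<rho> < e/4" "dist (snd q) x < d"
      using q(2) dist_fst_le[of q p] dist_snd_le[of q p] by (auto simp: p)
    have "\<bar>flow (fst q) (snd q) - flow \<rho> (snd q)\<bar> \<le> 2 * \<bar>fst q - \<rho>\<bar>"
      using q(1) by (intro flow_lipschitz) auto
    moreover have "dist (flow \<rho> (snd q)) (flow \<rho> x) < e/2" using d(2) q(1) 1 by auto
    ultimately show ?thesis
      using 1 dist_triangle[of "flow (fst q) (snd q)" "flow \<rho> x" "flow \<rho> (snd q)"]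
      by (simp add: dist_real_def)
  qed
  then show "\<exists>d>0. \<forall>q\<in>UNIV \<times> {0..2*pi}. dist q p < d \<longrightarrow>
      dist (flow (fst q) (snd q)) (flow (fst p) (snd p)) < e"
    using d e by (intro exI[of _ "min d (e/4)"]) (auto simp: p)
qed

text \<open>The derivative of the return map is the solution at \<open>2 \<pi>\<close> of the variational equation along the orbit.
The condition \<open>lin\<close> says that \<open>S'\<close> is the derivative of \<open>S\<close> in \<open>r\<close> along the orbit, uniformly in the
angle.\<close>
lemma return_derivative:
  assumes S': "continuous_on {0..2*pi} S'"
    and lin: "\<And>e. e > 0 \<Longrightarrow> \<exists>d>0. \<forall>x\<in>{0..2*pi}. \<forall>r. \<bar>r - flow \<rho> x\<bar> < d \<longrightarrow>
       \<bar>S r x - S (flow \<rho> x) x - S' x * (r - flow \<rho> x)\<bar> \<le> e * \<bar>r - flow \<rho> x\<bar>"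
  shows "((\<lambda>\<sigma>. flow \<sigma> (2*pi)) has_real_derivative exp (integral {0..2*pi} S')) (at \<rho>)"
proof -
  define E where "E x = exp (- integral {0..x} S')" for x
  have E': "(E has_real_derivative - S' x * E x) (at x within {0..2*pi})" if "x \<in> {0..2*pi}" for x
    unfolding E_def
    by (rule DERIV_cong[OF DERIV_chain2[OF DERIV_exp DERIV_minus[OF integral_has_real_derivative[OF S' that]]]]) simp
  have Ec: "continuous_on {0..2*pi} E" by (rule DERIV_continuous_on[OF E'])
  then obtain K where K: "K > 0" "\<And>x. x \<in> {0..2*pi} \<Longrightarrow> \<bar>E x\<bar> \<le> K"
    using compact_imp_bounded[OF compact_continuous_image[OF Ec]] 
    by (auto simp: bounded_pos)
  have E0: "E 0 = 1" by (simp add: E_def)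
  define D where "D = exp (integral {0..2*pi} S')"
  have D: "D * E (2*pi) = 1" "D > 0" by (simp_all add: D_def E_def exp_minus)
  show ?thesis
    unfolding has_field_derivative_def has_derivative_at_alt D_def[symmetric]
  proof (intro conjI allI impI)
    show "bounded_linear ((*) D)" by (rule bounded_linear_mult_right)
    fix e :: real assume e: "e > 0"
    \<comment> \<open>The error below is \<open>D K e'\<close> times the bound \<open>2 \<bar>\<sigma> - \<rho>\<bar>\<close> for \<open>\<bar>w\<bar>\<close> times the length \<open>2 \<pi>\<close> of the turn.\<close>
    define e' where "e' = e / (4 * pi * D * K)"
    have e': "e' > 0" using e D K by (simp add: e'_def)
    obtain d where d: "d > 0" "\<And>x r. x \<in> {0..2*pi} \<Longrightarrow> \<bar>r - flow \<rho> x\<bar> < d \<Longrightarrow>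
       \<bar>S r x - S (flow \<rho> x) x - S' x * (r - flow \<rho> x)\<bar> \<le> e' * \<bar>r - flow \<rho> x\<bar>"
      using lin[OF e'] by blast
    show "\<exists>d>0. \<forall>\<sigma>. norm (\<sigma> - \<rho>) < d \<longrightarrow>
          norm (flow \<sigma> (2*pi) - flow \<rho> (2*pi) - D * (\<sigma> - \<rho>)) \<le> e * norm (\<sigma> - \<rho>)"
    proof (intro exI[of _ "d/2"] conjI allI impI)
      fix \<sigma> assume \<sigma>: "norm (\<sigma> - \<rho>) < d/2"
      define w where "w = (\<lambda>x. flow \<sigma> x - flow \<rho> x)"
      have wb: "\<bar>w x\<bar> \<le> 2 * \<bar>\<sigma> - \<rho>\<bar>" if "x \<in> {0..2*pi}" for x
        using flow_lipschitz[OF that] by (simp add: w_def)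
      \<comment> \<open>The integrating factor \<open>E\<close> removes the linear part of \<open>w'\<close>; what is left is of size \<open>e' \<bar>w\<bar>\<close>, and \<open>\<bar>w\<bar>\<close> is at most
twice its initial value.\<close>
      have "norm (w (2*pi) * E (2*pi) - w 0 * E 0) \<le> (K * (e' * (2 * \<bar>\<sigma> - \<rho>\<bar>))) * norm (2*pi - 0)"
      proof (rule field_differentiable_bound[of "{0..2*pi}" "\<lambda>x. w x * E x"
            "\<lambda>x. E x * (S (flow \<sigma> x) x - S (flow \<rho> x) x - S' x * w x)"])
        fix x assume x: "x \<in> {0..2*pi}"
        show "((\<lambda>x. w x * E x) has_real_derivative E x * (S (flow \<sigma> x) x - S (flow \<rho> x) x - S' x * w x))
           (at x within {0..2*pi})"
          unfolding w_def
          by (rule DERIV_cong[OF DERIV_mult[OF DERIV_diff[OF flow_deriv[OF x] flow_deriv[OF x]] E'[OF x]]])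
            (simp add: algebra_simps)
        have "\<bar>S (flow \<sigma> x) x - S (flow \<rho> x) x - S' x * w x\<bar> \<le> e' * \<bar>w x\<bar>"
          using d(2)[OF x, of "flow \<sigma> x"] wb[OF x] \<sigma> by (simp add: w_def)
        also have "\<dots> \<le> e' * (2 * \<bar>\<sigma> - \<rho>\<bar>)" using wb[OF x] e' by (intro mult_left_mono) auto
        finally show "norm (E x * (S (flow \<sigma> x) x - S (flow \<rho> x) x - S' x * w x)) \<le> K * (e' * (2 * \<bar>\<sigma> - \<rho>\<bar>))"
          unfolding real_norm_def abs_mult using K e' x by (intro mult_mono) auto
      qed auto
      also have "\<dots> = e / D * \<bar>\<sigma> - \<rho>\<bar>" using D K by (simp add: e'_def field_simps)
      finally have 1: "\<bar>w (2*pi) * E (2*pi) - w 0\<bar> \<le> e / D * \<bar>\<sigma> - \<rho>\<bar>" by (simp add: E0)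
      have "flow \<sigma> (2*pi) - flow \<rho> (2*pi) - D * (\<sigma> - \<rho>) = D * (w (2*pi) * E (2*pi) - w 0)"
        unfolding right_diff_distrib[of D "w (2*pi) * E (2*pi)"] mult.left_commute[of D "w (2*pi)"] D(1)
        by (simp add: w_def)
      then have "norm (flow \<sigma> (2*pi) - flow \<rho> (2*pi) - D * (\<sigma> - \<rho>)) = D * \<bar>w (2*pi) * E (2*pi) - w 0\<bar>"
        using D by (simp add: abs_mult)
      also have "\<dots> \<le> D * (e / D * \<bar>\<sigma> - \<rho>\<bar>)" using 1 D by (intro mult_left_mono) auto
      also have "\<dots> = e * norm (\<sigma> - \<rho>)" using D by simp
      finally show "norm (flow \<sigma> (2*pi) - flow \<rho> (2*pi) - D * (\<sigma> - \<rho>)) \<le> e * norm (\<sigma> - \<rho>)" .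
    qed (use d in auto)
  qed
qed

end

section \<open>Planar fields in logarithmic polar coordinates\<close>

lemma polar_components_unique:
  assumes "p * cos x - q * sin x = p' * cos x - q' * sin x"
    and "p * sin x + q * cos x = p' * sin x + q' * (cos x :: real)"
  shows "p = p' \<and> q = q'"
proof -
  define a b where "a = p - p'" and "b = q - q'"
  have "(a\<^sup>2 + b\<^sup>2) * ((sin x)\<^sup>2 + (cos x)\<^sup>2) = (a * cos x - b * sin x)\<^sup>2 + (a * sin x + b * cos x)\<^sup>2"
  proof -
    have "(a\<^sup>2 + b\<^sup>2) * (s\<^sup>2 + c\<^sup>2) = (a * c - b * s)\<^sup>2 + (a * s + b * c)\<^sup>2" for s c
      by (simp add: power2_eq_square algebra_simps)
    then show ?thesis .
  qed
  moreover have "a * cos x - b * sin x = 0" "a * sin x + b * cos x = 0"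
    using assms by (simp_all add: a_def b_def algebra_simps)
  ultimately have "a\<^sup>2 + b\<^sup>2 = 0" by simp
  then show ?thesis by (simp add: sum_power2_eq_zero_iff a_def b_def)
qed

text \<open>Near a hyperbolic fixed point the distance to it is either always decreased or always increased.
Iterates can therefore not come back to where they started.\<close>
lemma hyperbolic_fixed_point:
  fixes P :: "real \<Rightarrow> real"
  assumes P: "(P has_real_derivative D) (at \<rho>)" "P \<rho> = \<rho>" and D: "\<bar>D\<bar> \<noteq> 1"
  obtains \<delta> where "0 < \<delta>"
    "(\<forall>\<sigma>. \<sigma> \<noteq> \<rho> \<and> \<bar>\<sigma> - \<rho>\<bar> < \<delta> \<longrightarrow> \<bar>P \<sigma> - \<rho>\<bar> < \<bar>\<sigma> - \<rho>\<bar>) \<or>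
     (\<forall>\<sigma>. \<sigma> \<noteq> \<rho> \<and> \<bar>\<sigma> - \<rho>\<bar> < \<delta> \<longrightarrow> \<bar>P \<sigma> - \<rho>\<bar> > \<bar>\<sigma> - \<rho>\<bar>)"
proof -
  have lim: "((\<lambda>\<sigma>. \<bar>(P \<sigma> - \<rho>) / (\<sigma> - \<rho>)\<bar>) \<longlongrightarrow> \<bar>D\<bar>) (at \<rho>)"
    using P by (intro tendsto_rabs) (simp add: has_field_derivative_iff)
  have q: "\<bar>(P \<sigma> - \<rho>) / (\<sigma> - \<rho>)\<bar> < 1 \<longleftrightarrow> \<bar>P \<sigma> - \<rho>\<bar> < \<bar>\<sigma> - \<rho>\<bar>"
    "\<bar>(P \<sigma> - \<rho>) / (\<sigma> - \<rho>)\<bar> > 1 \<longleftrightarrow> \<bar>P \<sigma> - \<rho>\<bar> > \<bar>\<sigma> - \<rho>\<bar>" if "\<sigma> \<noteq> \<rho>" for \<sigma>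
    using that by (auto simp: abs_divide divide_less_eq_1 less_divide_eq_1)
  consider "\<bar>D\<bar> < 1" | "\<bar>D\<bar> > 1" using D by linarith
  then show ?thesis
  proof cases
    case 1
    from order_tendstoD(2)[OF lim 1] obtain \<delta> where "\<delta> > 0"
      "\<And>\<sigma>. \<sigma> \<noteq> \<rho> \<Longrightarrow> \<bar>\<sigma> - \<rho>\<bar> < \<delta> \<Longrightarrow> \<bar>P \<sigma> - \<rho>\<bar> < \<bar>\<sigma> - \<rho>\<bar>"
      unfolding eventually_at dist_real_def using q(1) by blast
    then show ?thesis by (intro that[of \<delta>]) auto
  next
    case 2
    from order_tendstoD(1)[OF lim 2] obtain \<delta> where "\<delta> > 0"
      "\<And>\<sigma>. \<sigma> \<noteq> \<rho> \<Longrightarrow> \<bar>\<sigma> - \<rho>\<bar> < \<delta> \<Longrightarrow> \<bar>P \<sigma> - \<rho>\<bar> > \<bar>\<sigma> - \<rho>\<bar>"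
      unfolding eventually_at dist_real_def using q(2) by blast
    then show ?thesis by (intro that[of \<delta>]) auto
  qed
qed

text \<open>A field of the form \<open>r' = S B\<close>, \<open>\<theta>' = B\<close>, so that \<open>S = dr/d\<theta>\<close>. The field is required to have this form only
in the annulus \<open>c \<le> r \<le> d\<close>, whereas \<open>S\<close> and \<open>B\<close> are defined and bounded for all \<open>r\<close>; in applications they
are frozen outside the annulus. This lets the scalar equation be solved globally.\<close>
locale polar_flow = slow_flow S L M for S L M +
  fixes X :: vector_field and B :: "real \<Rightarrow> real \<Rightarrow> real" and c d :: real
  assumes X_cont: "continuous_on UNIV X"
    and B_cont: "continuous_on UNIV (\<lambda>p. B (fst p) (snd p))"
    and B_low: "\<And>r x. 1/2 \<le> B r x" and B_high: "\<And>r x. B r x \<le> 3/2"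
    and S_periodic: "\<And>r x. S r (x + 2 * pi) = S r x"
    and B_periodic: "\<And>r x. B r (x + 2 * pi) = B r x"
    and X_polar: "\<And>r x. r \<in> {c..d} \<Longrightarrow> X (pol r x) =
      (exp r * (S r x * B r x * cos x - B r x * sin x),
       exp r * (S r x * B r x * sin x + B r x * cos x))"
begin

lemma B_cont_comp:
  assumes "continuous_on A f" "continuous_on A g"
  shows "continuous_on A (\<lambda>x. B (f x) (g x))"
  using continuous_on_compose2[OF B_cont continuous_on_Pair[OF assms]] by simp

lemma B_pos: "0 < B r x" and B_nz: "B r x \<noteq> 0"
  using B_low[of r x] by linarith+

lemma S_shift: "S r (x + 2 * pi * of_int k) = S r x"
proof -
  interpret periodic_fun_simple "S r" "2 * pi" by standard (rule S_periodic)
  show ?thesis using plus_of_int[of x k] by (simp add: mult.commute)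
qed

lemma polar_solution:
  assumes "(r has_real_derivative S (r t) (x t) * B (r t) (x t)) (at t within A)"
    and "(x has_real_derivative B (r t) (x t)) (at t within A)" and "r t \<in> {c..d}"
  shows "((\<lambda>t. pol (r t) (x t)) has_vector_derivative X (pol (r t) (x t))) (at t within A)"
  using pol_derivative[OF assms(1,2)] X_polar[OF assms(3)] by simp

text \<open>Uniqueness for the planar field inside the annulus: the difference \<open>r - f(x)\<close> satisfies a linear
differential inequality. No change of time is made, so the solution need not be reparametrized by its
angle.\<close>
lemma follows_radial_solution:
  assumes r: "\<And>t. t \<in> {a..b} \<Longrightarrow> (r has_real_derivative S (r t) (x t) * B (r t) (x t)) (at t within {a..b})"
    and x: "\<And>t. t \<in> {a..b} \<Longrightarrow> (x has_real_derivative B (r t) (x t)) (at t within {a..b})"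
    and f: "\<And>y. y \<in> J \<Longrightarrow> (f has_real_derivative S (f y) y) (at y within J)"
    and J: "x ` {a..b} \<subseteq> J" and start: "f (x a) = r a" and t: "t \<in> {a..b}"
  shows "r t = f (x t)"
proof -
  have "r t - f (x t) = 0"
  proof (rule zero_of_linear_growth[where a=a and b=b and K="3/2 * L" and w="\<lambda>t. r t - f (x t)"
        and f="\<lambda>t. (S (r t) (x t) - S (f (x t)) (x t)) * B (r t) (x t)"])
    fix t assume t: "t \<in> {a..b}"
    have "(f has_real_derivative S (f (x t)) (x t)) (at (x t) within x ` {a..b})"
      by (rule has_field_derivative_subset[OF f J]) (use J t in auto)
    from DERIV_image_chain[OF this x[OF t]]
    have "((\<lambda>t. f (x t)) has_real_derivative S (f (x t)) (x t) * B (r t) (x t)) (at t within {a..b})"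
      by (simp add: o_def)
    from DERIV_diff[OF r[OF t] this]
    show "((\<lambda>t. r t - f (x t)) has_real_derivative (S (r t) (x t) - S (f (x t)) (x t)) * B (r t) (x t))
        (at t within {a..b})" by (simp add: algebra_simps)
    have "\<bar>S (r t) (x t) - S (f (x t)) (x t)\<bar> * \<bar>B (r t) (x t)\<bar> \<le> (L * \<bar>r t - f (x t)\<bar>) * (3/2)"
      using S_lip B_high[of "r t" "x t"] B_pos[of "r t" "x t"] L_nonneg by (intro mult_mono) auto
    then show "\<bar>(S (r t) (x t) - S (f (x t)) (x t)) * B (r t) (x t)\<bar> \<le> 3/2 * L * \<bar>r t - f (x t)\<bar>"
      by (simp add: abs_mult)
  qed (use start t in auto)
  then show ?thesis by simp
qed

definition turn_time :: "real \<Rightarrow> real" where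
  "turn_time \<rho> = integral {0..2*pi} (\<lambda>x. 1 / B (flow \<rho> x) x)"

lemma turn_time_continuous: "continuous_on UNIV turn_time"
proof -
  have flow_cont: "continuous_on (UNIV \<times> cbox 0 (2*pi)) (\<lambda>p. flow (fst p) (snd p))"
    unfolding cbox_interval by (rule flow_jointly_continuous)
  have "continuous_on (UNIV \<times> cbox 0 (2*pi)) (\<lambda>p. 1 / B (flow (fst p) (snd p)) (snd p))"
    by (intro continuous_on_divide continuous_on_const B_cont_comp flow_cont continuous_on_snd
        continuous_on_id) (simp add: B_nz)
  then have "continuous_on UNIV (\<lambda>\<rho>. integral (cbox 0 (2*pi)) (\<lambda>x. 1 / B (flow \<rho> x) x))"
    by (intro integral_continuous_on_param) (simp only: case_prod_beta')
  then show ?thesis unfolding turn_time_def[abs_def] cbox_interval .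
qed

text \<open>A solution of the scalar equation becomes one of the planar field by running through it with angular
speed \<open>B\<close>; the turn then takes the integral of \<open>1 / B\<close>.\<close>
lemma one_turn:
  assumes inside: "\<And>x. x \<in> {0..2*pi} \<Longrightarrow> flow \<rho> x \<in> {c..d}"
  obtains \<phi> where "solution_on X \<phi> {0..turn_time \<rho>}" "\<phi> 0 = pol \<rho> 0"
    "\<phi> (turn_time \<rho>) = pol (flow \<rho> (2*pi)) 0" "0 < turn_time \<rho>"
proof -
  \<comment> \<open>Clamping the angle extends the angular speed to the whole line, as inverting the time function requires.\<close>
  define cl where "cl x = max 0 (min (2*pi) x)" for x :: real
  have clid: "cl x = x" if "x \<in> {0..2*pi}" for x using that by (auto simp: cl_def)
  define h where "h x = B (flow \<rho> (cl x)) (cl x)" for x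
  have clc: "continuous_on UNIV cl" unfolding cl_def by (intro continuous_intros)
  have "continuous_on UNIV (\<lambda>x. flow \<rho> (cl x))"
    by (rule continuous_on_compose2[OF flow_continuous clc]) (auto simp: cl_def)
  then have hc: "continuous_on UNIV h" unfolding h_def by (intro B_cont_comp clc)
  have hlow: "1/2 \<le> h x" and hhigh: "h x \<le> 3/2" for x by (simp_all only: h_def B_low B_high)
  obtain \<theta> H where \<theta>': "\<And>t. (\<theta> has_real_derivative h (\<theta> t)) (at t)"
    and H': "\<And>x. (H has_real_derivative 1 / h x) (at x)" and \<theta>0: "\<theta> 0 = 0" and H0: "H 0 = 0"
    and \<theta>H: "\<And>x. \<theta> (H x) = x" and H\<theta>: "\<And>t. H (\<theta> t) = t" and mono: "strict_mono H" "strict_mono \<theta>"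
    by (rule autonomous_solution[OF hc _ hlow hhigh]) (simp, blast)
  have "((\<lambda>x. 1 / h x) has_integral (H (2*pi) - H 0)) {0..2*pi}"
    by (rule fundamental_theorem_of_calculus)
      (auto simp: has_real_derivative_iff_has_vector_derivative[symmetric] intro: has_field_derivative_at_within H')
  then have "((\<lambda>x. 1 / B (flow \<rho> x) x) has_integral (H (2*pi))) {0..2*pi}"
    unfolding H0 diff_0_right by (rule has_integral_eq[rotated]) (auto simp: h_def clid)
  then have T: "turn_time \<rho> = H (2*pi)" unfolding turn_time_def by (rule integral_unique)
  have Tpos: "0 < turn_time \<rho>" using strict_monoD[OF mono(1), of 0 "2*pi"] T H0 by simp
  have range: "\<theta> t \<in> {0..2*pi}" if "t \<in> {0..turn_time \<rho>}" for t
    using that mono(2) \<theta>0 \<theta>H[of "2*pi"] strict_mono_less_eq[OF mono(2), of 0 t]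
      strict_mono_less_eq[OF mono(2), of t "H (2*pi)"] by (auto simp: T)
  let ?\<phi> = "\<lambda>t. pol (flow \<rho> (\<theta> t)) (\<theta> t)"
  have "solution_on X ?\<phi> {0..turn_time \<rho>}"
    unfolding solution_on_def
  proof
    fix t assume t: "t \<in> {0..turn_time \<rho>}"
    let ?I = "{0..turn_time \<rho>}"
    have h: "h (\<theta> t) = B (flow \<rho> (\<theta> t)) (\<theta> t)" using range[OF t] by (simp add: h_def clid)
    have x': "(\<theta> has_real_derivative B (flow \<rho> (\<theta> t)) (\<theta> t)) (at t within ?I)"
      using has_field_derivative_at_within[OF \<theta>'[of t]] by (simp add: h)
    have "(flow \<rho> has_real_derivative S (flow \<rho> (\<theta> t)) (\<theta> t)) (at (\<theta> t) within \<theta> ` ?I)"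
      by (rule has_field_derivative_subset[OF flow_deriv]) (use range t in auto)
    from DERIV_image_chain[OF this x']
    show "(?\<phi> has_vector_derivative X (?\<phi> t)) (at t within ?I)"
      by (intro polar_solution x' inside range t) (simp add: o_def)
  qed
  moreover have "?\<phi> 0 = pol \<rho> 0" by (simp add: \<theta>0)
  moreover have "?\<phi> (turn_time \<rho>) = pol (flow \<rho> (2*pi)) 0"
    by (simp add: T \<theta>H pol_def)
  ultimately show ?thesis using Tpos by (rule that[of ?\<phi>])
qed

text \<open>The derivatives of the lift are read off from the field by comparing components in the moving frame.\<close>
lemma polar_lift_of_solution:
  assumes u: "solution_on X u UNIV" and annulus: "\<And>t. exp c < norm (u t) \<and> norm (u t) < exp d"
  obtains r x where "\<And>t. u t = pol (r t) (x t)" "\<And>t. c < r t \<and> r t < d"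
    "\<And>t. (r has_real_derivative S (r t) (x t) * B (r t) (x t)) (at t)"
    "\<And>t. (x has_real_derivative B (r t) (x t)) (at t)"
proof -
  have u': "(u has_vector_derivative X (u t)) (at t)" for t
    using u by (simp add: solution_on_def)
  have uc: "continuous_on UNIV u"
    by (rule continuous_on_vector_derivative[OF has_vector_derivative_at_within[OF u']])
  have Xc: "continuous_on UNIV (\<lambda>t. X (u t))"
    by (rule continuous_on_compose2[OF X_cont uc]) simp
  have "u t \<noteq> 0" for t using annulus[of t] by auto
  from polar_lift[OF u' Xc this] obtain r x r' x' where pol: "\<And>t. u t = pol (r t) (x t)"
    and r': "\<And>t. (r has_real_derivative r' t) (at t)" and x': "\<And>t. (x has_real_derivative x' t) (at t)"
    by blast
  have rng: "c < r t \<and> r t < d" for t using annulus[of t] by (simp add: pol)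
  have eqs: "r' t = S (r t) (x t) * B (r t) (x t) \<and> x' t = B (r t) (x t)" for t
  proof (rule polar_components_unique[of _ "x t"])
    have u_eq: "u = (\<lambda>t. pol (r t) (x t))" using pol by auto
    have "(u has_vector_derivative (exp (r t) * (r' t * cos (x t) - x' t * sin (x t)),
        exp (r t) * (r' t * sin (x t) + x' t * cos (x t)))) (at t)"
      using pol_derivative[OF r'[of t] x'[of t]] by (simp add: u_eq)
    from vector_derivative_unique_at[OF this u'[of t]]
    have "(exp (r t) * (r' t * cos (x t) - x' t * sin (x t)),
        exp (r t) * (r' t * sin (x t) + x' t * cos (x t))) = 
      (exp (r t) * (S (r t) (x t) * B (r t) (x t) * cos (x t) - B (r t) (x t) * sin (x t)),
       exp (r t) * (S (r t) (x t) * B (r t) (x t) * sin (x t) + B (r t) (x t) * cos (x t)))"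
      using X_polar[of "r t" "x t"] rng[of t] by (simp add: pol)
    then show "r' t * cos (x t) - x' t * sin (x t)
        = S (r t) (x t) * B (r t) (x t) * cos (x t) - B (r t) (x t) * sin (x t)"
      "r' t * sin (x t) + x' t * cos (x t)
        = S (r t) (x t) * B (r t) (x t) * sin (x t) + B (r t) (x t) * cos (x t)"
      by simp_all
  qed
  show ?thesis
  proof (rule that[of r x])
    show "(r has_real_derivative S (r t) (x t) * B (r t) (x t)) (at t)" for t
      using r'[of t] eqs[of t] by simp
    show "(x has_real_derivative B (r t) (x t)) (at t)" for t
      using x'[of t] eqs[of t] by simp
  qed (use pol rng in auto)
qed

end

section \<open>A hyperbolic fixed point of the return map is a hyperbolic limit cycle\<close>

text \<open>A hyperbolic fixed point \<open>\<rho>\<close> of the return map. The margin \<open>\<mu>\<close> keeps the neighbouring solutions inside the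
annulus during their first turn.\<close>
locale closed_turn = polar_flow S L M X B c d for S L M X B c d +
  fixes \<rho> \<mu> D :: real
  assumes \<mu>_pos: "0 < \<mu>"
    and closed: "flow \<rho> (2*pi) = \<rho>"
    and margin: "\<And>x. x \<in> {0..2*pi} \<Longrightarrow> c + \<mu> \<le> flow \<rho> x \<and> flow \<rho> x \<le> d - \<mu>"
    and return_deriv: "((\<lambda>\<sigma>. flow \<sigma> (2*pi)) has_real_derivative D) (at \<rho>)"
    and D_hyperbolic: "\<bar>D\<bar> \<noteq> 1"
begin

text \<open>The radial solution of the fixed point, extended periodically to all angles.\<close>
definition profile :: "real \<Rightarrow> real" where
  "profile x = flow \<rho> (x - 2 * pi * of_int \<lfloor>x / (2 * pi)\<rfloor>)"

lemma reduced_angle: "x - 2 * pi * of_int \<lfloor>x / (2 * pi)\<rfloor> \<in> {0..2*pi}"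
  using floor_divide_lower[of "2*pi" x] floor_divide_upper[of "2*pi" x]
  by (auto simp: algebra_simps)

lemma profile_eq_flow:
  assumes "x \<in> {0..2*pi}"
  shows "profile x = flow \<rho> x"
proof (cases "x = 2 * pi")
  case True
  then show ?thesis using closed by (simp add: profile_def)
next
  case False
  then have "\<lfloor>x / (2*pi)\<rfloor> = 0" using assms by (intro floor_unique) (auto simp: field_simps)
  then show ?thesis by (simp add: profile_def)
qed

lemma profile_shift: "profile (x + 2 * pi * of_int k) = profile x"
proof -
  have "(x + 2 * pi * of_int k) / (2 * pi) = x / (2 * pi) + of_int k" by (simp add: field_simps)
  then show ?thesis by (simp add: profile_def algebra_simps)
qed

lemma profile_turn: "profile (2 * pi * of_int k) = \<rho>"
  using profile_shift[of 0 k] profile_eq_flow[of 0] by simp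

lemma profile_deriv: "(profile has_real_derivative S (profile x) x) (at x)"
proof -
  have "((\<lambda>x. flow \<rho> (x - 2 * pi * of_int \<lfloor>x / (2 * pi)\<rfloor>)) has_real_derivative
     S (flow \<rho> (x - 2 * pi * of_int \<lfloor>x / (2 * pi)\<rfloor>)) (x - 2 * pi * of_int \<lfloor>x / (2 * pi)\<rfloor>)) (at x)"
    by (rule periodic_extension_derivative[where f="flow \<rho>" and f'="\<lambda>x. S (flow \<rho> x) x"])
      (use closed S_periodic[of \<rho> 0] flow_deriv in simp_all)
  moreover have "S r (x - 2 * pi * of_int \<lfloor>x / (2 * pi)\<rfloor>) = S r x" for r
    using S_shift[of r "x - 2 * pi * of_int \<lfloor>x / (2 * pi)\<rfloor>" "\<lfloor>x / (2 * pi)\<rfloor>"] by simp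
  ultimately show ?thesis by (simp add: profile_def[abs_def])
qed

lemma profile_range: "c < profile x \<and> profile x < d"
  using margin[OF reduced_angle[of x]] \<mu>_pos by (auto simp: profile_def)

definition cycle :: "(real \<times> real) set" where
  "cycle = range (\<lambda>x. pol (profile x) x)"

lemma cycle_solution:
  obtains u where "solution_on X u UNIV" "\<And>t. u (t + turn_time \<rho>) = u t" "u 0 = pol \<rho> 0"
    "\<And>t. 0 < t \<Longrightarrow> t < turn_time \<rho> \<Longrightarrow> u t \<noteq> u 0" "range u = cycle" "0 < turn_time \<rho>"
proof -
  define h where "h x = B (profile x) x" for x
  have "continuous_on UNIV profile"
    by (rule DERIV_continuous_on[OF has_field_derivative_at_within[OF profile_deriv]])
  then have hc: "continuous_on UNIV h" unfolding h_def by (intro B_cont_comp continuous_on_id)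
  have hlow: "1/2 \<le> h x" and hhigh: "h x \<le> 3/2" for x by (simp_all only: h_def B_low B_high)
  obtain \<theta> H where \<theta>': "\<And>t. (\<theta> has_real_derivative h (\<theta> t)) (at t)"
    and H': "\<And>x. (H has_real_derivative 1 / h x) (at x)" and \<theta>0: "\<theta> 0 = 0" and H0: "H 0 = 0"
    and \<theta>H: "\<And>x. \<theta> (H x) = x" and H\<theta>: "\<And>t. H (\<theta> t) = t" and mono: "strict_mono H" "strict_mono \<theta>"
    by (rule autonomous_solution[OF hc _ hlow hhigh]) (simp, blast)
  have "((\<lambda>x. 1 / h x) has_integral (H (2*pi) - H 0)) {0..2*pi}"
    by (rule fundamental_theorem_of_calculus)
      (auto simp: has_real_derivative_iff_has_vector_derivative[symmetric] intro: has_field_derivative_at_within H')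
  then have "((\<lambda>x. 1 / B (flow \<rho> x) x) has_integral (H (2*pi))) {0..2*pi}"
    unfolding H0 diff_0_right by (rule has_integral_eq[rotated]) (simp add: h_def profile_eq_flow)
  then have T: "turn_time \<rho> = H (2*pi)" unfolding turn_time_def by (rule integral_unique)
  have Tpos: "0 < turn_time \<rho>" using strict_monoD[OF mono(1), of 0 "2*pi"] T H0 by simp
  have h_per: "h (x + 2*pi) = h x" for x
    using profile_shift[of x 1] by (simp add: h_def B_periodic)
  have "((\<lambda>x. H (x + 2*pi) - H x) has_real_derivative 0) (at x)" for x
  proof -
    have "((\<lambda>x. H (x + 2*pi)) has_real_derivative 1 / h x) (at x)"
      using H'[of "x + 2*pi"] by (simp add: DERIV_shift h_per)
    from DERIV_diff[OF this H'[of x]] show ?thesis by simp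
  qed
  then have "H (x + 2*pi) - H x = H (0 + 2*pi) - H 0" for x
    using DERIV_const_ratio_const2 DERIV_isconst_all by blast
  then have H_shift: "H (x + 2*pi) = H x + turn_time \<rho>" for x by (simp add: T H0 algebra_simps)
  have \<theta>_shift: "\<theta> (t + turn_time \<rho>) = \<theta> t + 2*pi" for t
    using \<theta>H[of "\<theta> t + 2*pi"] by (simp add: H_shift H\<theta>)
  define u where "u t = pol (profile (\<theta> t)) (\<theta> t)" for t
  show ?thesis
  proof (rule that[of u])
    have "(u has_vector_derivative X (u t)) (at t)" for t
      unfolding u_def
    proof (rule polar_solution)
      show "(\<theta> has_real_derivative B (profile (\<theta> t)) (\<theta> t)) (at t)"
        using \<theta>'[of t] by (simp add: h_def)
      from DERIV_chain2[OF profile_deriv[of "\<theta> t"] this]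
      show "((\<lambda>t. profile (\<theta> t)) has_real_derivative S (profile (\<theta> t)) (\<theta> t) * B (profile (\<theta> t)) (\<theta> t)) (at t)" .
      show "profile (\<theta> t) \<in> {c..d}" using profile_range[of "\<theta> t"] by simp
    qed
    then show "solution_on X u UNIV" by (simp add: solution_on_def)
    show "u (t + turn_time \<rho>) = u t" for t
      unfolding u_def \<theta>_shift pol_eq_iff
      using profile_shift[of "\<theta> t" 1] by (auto intro!: exI[of _ "1::int"])
    show u0: "u 0 = pol \<rho> 0" using profile_turn[of 0] by (simp add: u_def \<theta>0)
    show "u t \<noteq> u 0" if "0 < t" "t < turn_time \<rho>" for t
    proof
      assume "u t = u 0"
      then obtain k :: int where k: "\<theta> t = 2 * pi * of_int k" by (auto simp: u_def \<theta>0 pol_eq_iff)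
      have "0 < \<theta> t" using strict_monoD[OF mono(2) that(1)] \<theta>0 by simp
      moreover have "\<theta> t < 2 * pi" using strict_monoD[OF mono(2) that(2)] by (simp add: T \<theta>H)
      ultimately have "0 < real_of_int k" "real_of_int k < 1"
        by (simp_all add: k zero_less_mult_iff)
      then have "0 < k" "k < 1" by simp_all
      then show False by linarith
    qed
    have "surj \<theta>" using \<theta>H by (metis surjI)
    then show "range u = cycle"
      unfolding cycle_def u_def[abs_def] using image_image[of "\<lambda>x. pol (profile x) x" \<theta> UNIV] by simp
  qed (rule Tpos)
qed

text \<open>From the annulus \<open>U\<close> removes the part of the positive horizontal axis where \<open>r\<close> is not close to \<open>\<rho>\<close>. This is
open, because the removed set is closed in the annulus, and a periodic orbit in \<open>U\<close>, which keeps turning around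
the origin, crosses the axis only where the return map has the contraction or expansion property of
a hyperbolic fixed point. As the orbit is periodic, its first crossing recurs after \<open>k\<close> turns; hence it is
the fixed point, and the orbit is the cycle by uniqueness.\<close>
lemma cycle_isolated:
  obtains U where "open U" "cycle \<subseteq> U" "\<And>\<gamma>. periodic_orbit X \<gamma> \<Longrightarrow> \<gamma> \<subseteq> U \<Longrightarrow> \<gamma> = cycle"
    "U \<subseteq> {p. exp c < norm p \<and> norm p < exp d}"
proof -
  obtain \<delta> where \<delta>: "0 < \<delta>"
    "(\<forall>\<sigma>. \<sigma> \<noteq> \<rho> \<and> \<bar>\<sigma> - \<rho>\<bar> < \<delta> \<longrightarrow> \<bar>flow \<sigma> (2*pi) - \<rho>\<bar> < \<bar>\<sigma> - \<rho>\<bar>) \<or>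
     (\<forall>\<sigma>. \<sigma> \<noteq> \<rho> \<and> \<bar>\<sigma> - \<rho>\<bar> < \<delta> \<longrightarrow> \<bar>flow \<sigma> (2*pi) - \<rho>\<bar> > \<bar>\<sigma> - \<rho>\<bar>)"
    using hyperbolic_fixed_point[OF return_deriv closed D_hyperbolic] by blast
  define U :: "(real \<times> real) set" where "U = {p. exp c < norm p \<and> norm p < exp d} \<inter>
    ({p. snd p \<noteq> 0} \<union> {p. fst p < 0} \<union> {p. exp (\<rho> - \<delta>) < fst p \<and> fst p < exp (\<rho> + \<delta>)})"
  show ?thesis
  proof (rule that[of U])
    show "open U"
      unfolding U_def by (intro open_Int open_Un open_Collect_conj open_Collect_less open_Collect_neq continuous_intros)
    show "U \<subseteq> {p. exp c < norm p \<and> norm p < exp d}" by (auto simp: U_def)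
    show "cycle \<subseteq> U"
    proof
      fix p assume "p \<in> cycle"
      then obtain x where p: "p = pol (profile x) x" by (auto simp: cycle_def)
      have "p \<in> {p. exp (\<rho> - \<delta>) < fst p \<and> fst p < exp (\<rho> + \<delta>)}" if "snd p = 0" "\<not> fst p < 0"
      proof -
        have s: "sin x = 0" and co: "cos x \<ge> 0" using that by (auto simp: p pol_def mult_less_0_iff)
        have "cos x = 1" using s co sin_cos_squared_add[of x] by (simp add: power2_eq_1_iff)
        then obtain n :: int where "x = of_int n * 2 * pi" by (auto simp: cos_one_2pi_int)
        then have x: "x = 2 * pi * of_int n" by simp
        have "profile x = \<rho>" unfolding x by (rule profile_turn)
        then have "p = (exp \<rho>, 0)" using s \<open>cos x = 1\<close> by (simp add: p pol_def)
        then show ?thesis using \<delta>(1) by simp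
      qed
      then show "p \<in> U" using profile_range[of x] by (auto simp: U_def p)
    qed
    fix \<gamma> assume "periodic_orbit X \<gamma>" and sub: "\<gamma> \<subseteq> U"
    then obtain u T where T: "0 < T" and sol: "solution_on X u UNIV" and per: "\<And>t. u (t + T) = u t"
      and \<gamma>: "\<gamma> = range u" by (auto simp: periodic_orbit_def)
    have uU: "u t \<in> U" for t using sub \<gamma> by auto
    then have "exp c < norm (u t) \<and> norm (u t) < exp d" for t by (auto simp: U_def)
    from polar_lift_of_solution[OF sol this] obtain r x where
      u: "\<And>t. u t = pol (r t) (x t)" and rng: "\<And>t. c < r t \<and> r t < d"
      and r': "\<And>t. (r has_real_derivative S (r t) (x t) * B (r t) (x t)) (at t)"
      and x': "\<And>t. (x has_real_derivative B (r t) (x t)) (at t)" by blast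
    have x_mono: "strict_mono x"
      by (rule strict_monoI, rule DERIV_pos_imp_increasing) (use x' B_pos in blast)+
    have xc: "continuous_on A x" for A
      by (rule DERIV_continuous_on[OF has_field_derivative_at_within[OF x']])
    have x_grow: "x 0 + t / 2 \<le> x t" if "0 \<le> t" for t
    proof -
      have "(\<lambda>t. x t - t / 2) 0 \<le> (\<lambda>t. x t - t / 2) t"
      proof (rule DERIV_nonneg_imp_nondecreasing[OF that])
        fix s
        have "((\<lambda>t. x t - t / 2) has_real_derivative B (r s) (x s) - 1 / 2) (at s)"
          by (intro DERIV_diff x') (auto intro!: derivative_eq_intros)
        then show "\<exists>y. ((\<lambda>t. x t - t / 2) has_real_derivative y) (at s) \<and> 0 \<le> y"
          using B_low[of "r s" "x s"] by (intro exI conjI) auto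
      qed
      then show ?thesis by simp
    qed
    have x_onto: "\<exists>t\<ge>0. x t = y" if "x 0 \<le> y" for y
    proof -
      have "0 \<le> 2 * (y - x 0)" using that by simp
      moreover have "x 0 + 2 * (y - x 0) / 2 = y" by argo
      ultimately have "y \<le> x (2 * (y - x 0))" using x_grow by metis
      from IVT'[OF that this _ xc] that show ?thesis by auto
    qed
    define N where "N = \<lceil>x 0 / (2 * pi)\<rceil>"
    have N: "x 0 \<le> 2 * pi * of_int N"
      using ceiling_divide_upper[of "2*pi" "x 0"] by (simp add: N_def mult.commute)
    have "\<exists>t. x t = 2 * pi * of_int (N + int i)" for i
    proof -
      have "2 * pi * of_int N \<le> 2 * pi * of_int (N + int i)" by (intro mult_left_mono) auto
      with N have "x 0 \<le> 2 * pi * of_int (N + int i)" by (rule order_trans)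
      from x_onto[OF this] show ?thesis by blast
    qed
    \<comment> \<open>The orbit crosses the positive horizontal axis at the times \<open>s i\<close>, when its lifted angle is a multiple of \<open>2 \<pi>\<close>.\<close>
    then obtain s where s: "\<And>i. x (s i) = 2 * pi * of_int (N + int i)" by metis
    have step: "r (s (Suc i)) = flow (r (s i)) (2 * pi)" for i
    proof -
      let ?a = "2 * pi * of_int (N + int i)"
      have si: "s i \<le> s (Suc i)"
        using strict_mono_less_eq[OF x_mono, of "s i" "s (Suc i)"] by (simp add: s)
      have "r (s (Suc i)) = flow (r (s i)) (x (s (Suc i)) - ?a)"
      proof (rule follows_radial_solution[where a="s i" and b="s (Suc i)" and J="{?a..?a + 2*pi}"
            and r=r and x=x and f="\<lambda>y. flow (r (s i)) (y - ?a)" and t="s (Suc i)"])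
        fix y assume y: "y \<in> {?a..?a + 2*pi}"
        have "(\<lambda>y. y - ?a) ` {?a..?a + 2*pi} \<subseteq> {0..2*pi}" by auto
        then have "(flow (r (s i)) has_real_derivative S (flow (r (s i)) (y - ?a)) (y - ?a))
            (at (y - ?a) within (\<lambda>y. y - ?a) ` {?a..?a + 2*pi})"
          by (rule has_field_derivative_subset[OF flow_deriv, rotated]) (use y in auto)
        moreover have "((\<lambda>y. y - ?a) has_real_derivative 1) (at y within {?a..?a + 2*pi})"
          by (auto intro!: derivative_eq_intros)
        ultimately have "((\<lambda>y. flow (r (s i)) (y - ?a)) has_real_derivative S (flow (r (s i)) (y - ?a)) (y - ?a))
            (at y within {?a..?a + 2*pi})"
          using DERIV_image_chain[of "flow (r (s i))" _ "\<lambda>y. y - ?a" y "{?a..?a + 2*pi}" 1] by (simp add: o_def)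
        moreover have "S q (y - ?a) = S q y" for q
          using S_shift[of q "y - ?a" "N + int i"] by simp
        ultimately show "((\<lambda>y. flow (r (s i)) (y - ?a)) has_real_derivative S (flow (r (s i)) (y - ?a)) y)
            (at y within {?a..?a + 2*pi})" by simp
      next
        show "x ` {s i..s (Suc i)} \<subseteq> {?a..?a + 2*pi}"
        proof
          fix y assume "y \<in> x ` {s i..s (Suc i)}"
          then obtain t where t: "s i \<le> t" "t \<le> s (Suc i)" "y = x t" by auto
          have "x (s i) \<le> x t" "x t \<le> x (s (Suc i))"
            using t strict_mono_less_eq[OF x_mono] by simp_all
          then show "y \<in> {?a..?a + 2*pi}" by (simp add: s t(3) algebra_simps)
        qed
      qed (use si s has_field_derivative_at_within[OF r'] has_field_derivative_at_within[OF x'] in auto)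
      moreover have "x (s (Suc i)) - ?a = 2 * pi" by (simp add: s algebra_simps)
      ultimately show ?thesis by simp
    qed
    have near: "\<bar>r (s i) - \<rho>\<bar> < \<delta>" for i
    proof -
      have "u (s i) = (exp (r (s i)), 0)"
      proof -
        have "u (s i) = pol (r (s i)) 0" unfolding u s pol_eq_iff
          by (intro conjI exI[of _ "N + int i"]) simp_all
        then show ?thesis by (simp add: pol_def)
      qed
      then have "exp (\<rho> - \<delta>) < exp (r (s i)) \<and> exp (r (s i)) < exp (\<rho> + \<delta>)"
        using uU[of "s i"] by (auto simp: U_def)
      then show ?thesis by auto
    qed
    have returns: "\<exists>k\<ge>1. r (s k) = r (s 0)"
    proof -
      have "pol (r (s 0 + T)) (x (s 0 + T)) = pol (r (s 0)) (x (s 0))"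
        using per[of "s 0"] by (simp add: u)
      then obtain k :: int where k: "r (s 0 + T) = r (s 0)" "x (s 0 + T) = x (s 0) + 2 * pi * of_int k"
        by (auto simp: pol_eq_iff)
      have "x (s 0) < x (s 0 + T)" using T by (intro strict_monoD[OF x_mono]) simp
      then have "0 < real_of_int k" by (simp add: k zero_less_mult_iff)
      then have kpos: "0 < k" by simp
      then have "x (s (nat k)) = x (s 0 + T)" by (simp add: k(2) s distrib_left)
      then have "s (nat k) = s 0 + T" using strict_mono_eq[OF x_mono] by simp
      then show ?thesis using k(1) kpos by (intro exI[of _ "nat k"]) auto
    qed
    \<comment> \<open>Otherwise the distances of the crossings to \<open>\<rho>\<close> are monotone, with a strict first step, contradicting the
recurrence.\<close>
    have r0: "r (s 0) = \<rho>"
    proof (rule ccontr)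
      assume ne: "r (s 0) \<noteq> \<rho>"
      let ?e = "\<lambda>i. \<bar>r (s i) - \<rho>\<bar>"
      have closed_step: "r (s (Suc i)) = \<rho>" if "r (s i) = \<rho>" for i
        using that closed by (simp add: step)
      obtain k where k: "k \<ge> 1" "?e k = ?e 0" using returns by auto
      from \<delta>(2) show False
      proof
        assume attr: "\<forall>\<sigma>. \<sigma> \<noteq> \<rho> \<and> \<bar>\<sigma> - \<rho>\<bar> < \<delta> \<longrightarrow> \<bar>flow \<sigma> (2*pi) - \<rho>\<bar> < \<bar>\<sigma> - \<rho>\<bar>"
        have le: "?e (Suc i) \<le> ?e i" for i
          using attr[rule_format, of "r (s i)"] near[of i] closed_step[of i]
          by (cases "r (s i) = \<rho>") (auto simp: step[of i])
        have "?e k \<le> ?e 1" using lift_Suc_antimono_le[of ?e, OF le k(1)] .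
        moreover have "?e 1 < ?e 0" using attr[rule_format, of "r (s 0)"] near[of 0] ne by (simp add: step[of 0])
        ultimately show False using k by linarith
      next
        assume rep: "\<forall>\<sigma>. \<sigma> \<noteq> \<rho> \<and> \<bar>\<sigma> - \<rho>\<bar> < \<delta> \<longrightarrow> \<bar>flow \<sigma> (2*pi) - \<rho>\<bar> > \<bar>\<sigma> - \<rho>\<bar>"
        have le: "?e i \<le> ?e (Suc i)" for i
          using rep[rule_format, of "r (s i)"] near[of i] closed_step[of i]
          by (cases "r (s i) = \<rho>") (auto simp: step[of i])
        have "?e 1 \<le> ?e k" using lift_Suc_mono_le[of ?e, OF le k(1)] .
        moreover have "?e 0 < ?e 1" using rep[rule_format, of "r (s 0)"] near[of 0] ne by (simp add: step[of 0])
        ultimately show False using k by linarith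
      qed
    qed
    have on_profile: "r t = profile (x t)" if "s 0 \<le> t" for t
      by (rule follows_radial_solution[where a="s 0" and b=t and J=UNIV and r=r and x=x and f=profile])
        (use that s r0 profile_turn has_field_derivative_at_within[OF r'] has_field_derivative_at_within[OF x']
          has_field_derivative_at_within[OF profile_deriv] in auto)
    have u_shift: "u (t + real n * T) = u t" for t n
    proof (induction n)
      case (Suc n)
      then show ?case using per[of "t + real n * T"] by (simp add: algebra_simps)
    qed simp
    show "\<gamma> = cycle"
    proof
      show "\<gamma> \<subseteq> cycle"
      proof
        fix p assume "p \<in> \<gamma>"
        then obtain t where t: "p = u t" by (auto simp: \<gamma>)
        obtain n :: nat where n: "(s 0 - t) / T < real n" using reals_Archimedean2 by blast
        then have "s 0 \<le> t + real n * T" using T by (simp add: field_simps)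
        then have "p = pol (profile (x (t + real n * T))) (x (t + real n * T))"
          using u_shift[of t n] on_profile[of "t + real n * T"] u[of "t + real n * T"] by (simp only: t)
        then show "p \<in> cycle" unfolding cycle_def by (rule range_eqI)
      qed
      show "cycle \<subseteq> \<gamma>"
      proof
        fix p assume "p \<in> cycle"
        then obtain y where p: "p = pol (profile y) y" by (auto simp: cycle_def)
        define k where "k = \<lceil>(x (s 0) - y) / (2 * pi)\<rceil>"
        have ky: "x (s 0) \<le> y + 2 * pi * of_int k"
          using ceiling_divide_upper[of "2*pi" "x (s 0) - y"] by (simp add: k_def mult.commute algebra_simps)
        have "x 0 \<le> x (s 0)" using N by (simp add: s)
        with ky obtain t where t: "x t = y + 2 * pi * of_int k" using x_onto[of "y + 2 * pi * of_int k"] by auto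
        have "s 0 \<le> t" using ky strict_mono_less_eq[OF x_mono, of "s 0" t] by (simp add: t)
        then have "u t = pol (profile y) (y + 2 * pi * of_int k)"
          using on_profile[of t] by (simp add: u t profile_shift)
        also have "\<dots> = p" by (auto simp: p pol_eq_iff)
        finally show "p \<in> \<gamma>" by (auto simp: \<gamma>)
      qed
    qed
  qed
qed

text \<open>The section is the horizontal axis with the Euclidean coordinate \<open>s\<close> centred at \<open>exp \<rho>\<close>, where the return
map is conjugate to \<open>\<lambda>\<sigma>. flow \<sigma> (2*pi)\<close> by \<open>s \<mapsto> ln (exp \<rho> + s)\<close>. Hence it has the same derivative \<open>D\<close> at the
fixed point.\<close>
theorem hyperbolic_cycle:
  "hyperbolic_limit_cycle X cycle \<and> cycle \<subseteq> {p. exp c < norm p \<and> norm p < exp d}"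
proof -
  obtain u where sol: "solution_on X u UNIV" and per: "\<And>t. u (t + turn_time \<rho>) = u t"
    and u0: "u 0 = pol \<rho> 0" and least: "\<And>t. 0 < t \<Longrightarrow> t < turn_time \<rho> \<Longrightarrow> u t \<noteq> u 0"
    and ran: "range u = cycle" and T: "0 < turn_time \<rho>" using cycle_solution by metis
  obtain U where U: "open U" "cycle \<subseteq> U" "\<And>\<gamma>. periodic_orbit X \<gamma> \<Longrightarrow> \<gamma> \<subseteq> U \<Longrightarrow> \<gamma> = cycle"
    "U \<subseteq> {p. exp c < norm p \<and> norm p < exp d}" using cycle_isolated by metis
  have "u (turn_time \<rho> / 2) \<noteq> u 0" using least[of "turn_time \<rho> / 2"] T by simp
  then have "periodic_orbit X cycle"
    unfolding periodic_orbit_def using sol per ran T by blast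
  then have lc: "limit_cycle X cycle" unfolding limit_cycle_def using U by blast
  define lr where "lr s = ln (exp \<rho> + s)" for s
  define P where "P s = exp (flow (lr s) (2*pi)) - exp \<rho>" for s
  have lr0: "lr 0 = \<rho>" by (simp add: lr_def)
  have lr': "(lr has_real_derivative 1 / exp \<rho>) (at 0)"
    unfolding lr_def by (auto intro!: derivative_eq_intros)
  have "isCont lr 0" using lr' by (rule DERIV_isCont)
  then obtain \<delta>0 where \<delta>0: "0 < \<delta>0" "\<And>s. \<bar>s\<bar> < \<delta>0 \<Longrightarrow> \<bar>lr s - \<rho>\<bar> < \<mu> / 2"
    unfolding isCont_def LIM_def dist_real_def lr0 using \<mu>_pos
    by (metis abs_zero diff_0_right half_gt_zero lr0 diff_self)
  define \<delta> where "\<delta> = min \<delta>0 (exp \<rho>)"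
  have \<delta>: "0 < \<delta>" using \<delta>0 by (simp add: \<delta>_def)
  have \<delta>_le: "- exp \<rho> \<le> - \<delta>" by (simp add: \<delta>_def)
  have base: "pol (lr s) 0 = u 0 + s *\<^sub>R (1, 0)" if "s \<in> {-\<delta><..<\<delta>}" for s
  proof -
    have "0 < exp \<rho> + s" using that \<delta>_le by auto
    then show ?thesis by (simp add: u0 pol_def lr_def)
  qed
  have turn: "\<exists>\<phi>. 0 < turn_time (lr s) \<and> solution_on X \<phi> {0..turn_time (lr s)} \<and>
      \<phi> 0 = u 0 + s *\<^sub>R (1, 0) \<and> \<phi> (turn_time (lr s)) = u 0 + P s *\<^sub>R (1, 0)"
    if s: "s \<in> {-\<delta><..<\<delta>}" for s
  proof -
    have "\<bar>lr s - \<rho>\<bar> < \<mu> / 2" using s by (intro \<delta>0) (auto simp: \<delta>_def)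
    then have "c \<le> flow (lr s) x" "flow (lr s) x \<le> d" if "x \<in> {0..2*pi}" for x
      using flow_lipschitz[OF that, of "lr s" \<rho>] margin[OF that] by argo+
    then have "\<And>x. x \<in> {0..2*pi} \<Longrightarrow> flow (lr s) x \<in> {c..d}" by simp
    from one_turn[OF this] obtain \<phi> where \<phi>: "solution_on X \<phi> {0..turn_time (lr s)}" "\<phi> 0 = pol (lr s) 0"
      "\<phi> (turn_time (lr s)) = pol (flow (lr s) (2*pi)) 0" "0 < turn_time (lr s)" by blast
    moreover have "pol (flow (lr s) (2*pi)) 0 = u 0 + P s *\<^sub>R (1, 0)" by (simp add: u0 P_def pol_def)
    ultimately show ?thesis using base[OF s] by metis
  qed
  then obtain \<phi> where \<phi>: "\<And>s. s \<in> {-\<delta><..<\<delta>} \<Longrightarrow> 0 < turn_time (lr s) \<and> solution_on X (\<phi> s) {0..turn_time (lr s)} \<and>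
      \<phi> s 0 = u 0 + s *\<^sub>R (1, 0) \<and> \<phi> s (turn_time (lr s)) = u 0 + P s *\<^sub>R (1, 0)"
    by metis
  have "continuous_on {-\<delta><..<\<delta>} lr"
    unfolding lr_def using \<delta>_le by (intro continuous_intros) auto
  then have "continuous_on {-\<delta><..<\<delta>} (\<lambda>s. turn_time (lr s))"
    by (rule continuous_on_compose2[OF turn_time_continuous]) simp
  then have ret: "return_map X (u 0) (1, 0) (turn_time \<rho>) P"
    unfolding return_map_def using \<delta> \<phi> lr0
    by (intro exI[of _ \<delta>] conjI exI[of _ "\<lambda>s. turn_time (lr s)"] exI[of _ \<phi>]) auto
  have "((\<lambda>s. flow (lr s) (2*pi)) has_real_derivative D * (1 / exp \<rho>)) (at 0)"
    by (rule DERIV_chain2[OF _ lr']) (simp add: lr0 return_deriv)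
  from DERIV_chain2[OF DERIV_exp this]
  have P': "(P has_real_derivative D) (at 0)"
    unfolding P_def[abs_def] by (intro DERIV_cong[OF DERIV_diff[OF _ DERIV_const]]) (auto simp: lr0 closed)
  have "snd (X (u 0)) \<noteq> 0"
    using X_polar[of \<rho> 0] profile_range[of 0] profile_turn[of 0] B_nz by (simp add: u0)
  then have "hyperbolic_limit_cycle X cycle"
    unfolding hyperbolic_limit_cycle_def using lc T sol per least ran ret P' D_hyperbolic
    by (intro conjI exI[of _ u] exI[of _ "turn_time \<rho>"] exI[of _ "(1,0)"] exI[of _ P] exI[of _ D]) auto
  then show ?thesis using U by blast
qed

end

section \<open>First-order averaging\<close>

text \<open>By compactness \<open>f'\<close> is uniformly continuous; the mean value theorem transfers this to \<open>f\<close>.\<close>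
lemma uniform_linearization:
  fixes f f' :: "real \<Rightarrow> real \<Rightarrow> real"
  assumes f': "\<And>r x. r \<in> {c..d} \<Longrightarrow> x \<in> {a..b} \<Longrightarrow> ((\<lambda>r. f r x) has_real_derivative f' r x) (at r within {c..d})"
    and cont: "continuous_on ({c..d} \<times> {a..b}) (\<lambda>p. f' (fst p) (snd p))" and e: "0 < e"
  obtains \<delta> where "0 < \<delta>"
    "\<And>r s x. r \<in> {c..d} \<Longrightarrow> s \<in> {c..d} \<Longrightarrow> x \<in> {a..b} \<Longrightarrow> \<bar>r - s\<bar> < \<delta> \<Longrightarrow> \<bar>f' r x - f' s x\<bar> \<le> e"
    "\<And>r s x. r \<in> {c..d} \<Longrightarrow> s \<in> {c..d} \<Longrightarrow> x \<in> {a..b} \<Longrightarrow> \<bar>r - s\<bar> < \<delta> \<Longrightarrow>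
       \<bar>f r x - f s x - f' s x * (r - s)\<bar> \<le> e * \<bar>r - s\<bar>"
proof -
  have "uniformly_continuous_on ({c..d} \<times> {a..b}) (\<lambda>p. f' (fst p) (snd p))"
    by (rule compact_uniformly_continuous[OF cont]) (intro compact_Times compact_Icc)
  then obtain \<delta> where \<delta>: "0 < \<delta>" "\<And>p q. p \<in> {c..d} \<times> {a..b} \<Longrightarrow> q \<in> {c..d} \<times> {a..b} \<Longrightarrow>
      dist p q < \<delta> \<Longrightarrow> dist (f' (fst p) (snd p)) (f' (fst q) (snd q)) < e"
    unfolding uniformly_continuous_on_def using e by blast
  have close: "\<bar>f' r x - f' s x\<bar> \<le> e" if "r \<in> {c..d}" "s \<in> {c..d}" "x \<in> {a..b}" "\<bar>r - s\<bar> < \<delta>" for r s x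
    using \<delta>(2)[of "(r, x)" "(s, x)"] that by (simp add: dist_Pair_Pair dist_real_def)
  show ?thesis
  proof (rule that[OF \<delta>(1) close])
    fix r s x assume *: "r \<in> {c..d}" "s \<in> {c..d}" "x \<in> {a..b}" "\<bar>r - s\<bar> < \<delta>"
    let ?I = "{min r s..max r s}"
    have sub: "?I \<subseteq> {c..d}" using * by auto
    have "norm ((f r x - f' s x * r) - (f s x - f' s x * s)) \<le> e * norm (r - s)"
    proof (rule field_differentiable_bound[of ?I "\<lambda>r. f r x - f' s x * r" "\<lambda>r. f' r x - f' s x"])
      fix q assume q: "q \<in> ?I"
      then have q': "q \<in> {c..d}" using sub by blast
      have "((\<lambda>r. f r x) has_real_derivative f' q x) (at q within ?I)"
        by (rule has_field_derivative_subset[OF f'[OF q' *(3)] sub])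
      then show "((\<lambda>r. f r x - f' s x * r) has_real_derivative f' q x - f' s x) (at q within ?I)"
        by (auto intro!: derivative_eq_intros)
      have "\<bar>q - s\<bar> < \<delta>" using q *(4) by auto
      then show "norm (f' q x - f' s x) \<le> e" using close[OF q' *(2,3)] by simp
    qed auto
    then show "\<bar>f r x - f s x - f' s x * (r - s)\<bar> \<le> e * \<bar>r - s\<bar>" by (simp add: algebra_simps)
  qed
qed

lemma periodic_bounded:
  fixes f :: "real \<Rightarrow> real \<Rightarrow> real"
  assumes cont: "continuous_on UNIV (\<lambda>p. f (fst p) (snd p))" and per: "\<And>r x. f r (x + 2*pi) = f r x"
  obtains K where "0 < K" "\<And>r x. r \<in> {c..d} \<Longrightarrow> \<bar>f r x\<bar> \<le> K"
proof -
  have "bounded ((\<lambda>p. f (fst p) (snd p)) ` ({c..d} \<times> {0..2*pi}))"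
    by (intro compact_imp_bounded compact_continuous_image continuous_on_subset[OF cont] compact_Times compact_Icc) simp
  then obtain K where K: "0 < K" "\<And>r x. r \<in> {c..d} \<Longrightarrow> x \<in> {0..2*pi} \<Longrightarrow> \<bar>f r x\<bar> \<le> K"
    unfolding bounded_pos by force
  have "\<bar>f r x\<bar> \<le> K" if "r \<in> {c..d}" for r x
  proof -
    interpret periodic_fun_simple "f r" "2 * pi" by standard (rule per)
    define y where "y = x - 2 * pi * of_int \<lfloor>x / (2 * pi)\<rfloor>"
    have "y \<in> {0..2*pi}"
      using floor_divide_lower[of "2*pi" x] floor_divide_upper[of "2*pi" x] by (auto simp: y_def algebra_simps)
    moreover have "f r y = f r x"
      using minus_of_int[of x "\<lfloor>x / (2 * pi)\<rfloor>"] by (simp add: y_def mult.commute)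
    ultimately show ?thesis using K(2)[OF that] by metis
  qed
  then show ?thesis using that K(1) by blast
qed

text \<open>For the slope \<open>q = \<epsilon> f / (1 + \<epsilon> g)\<close>, with derivative \<open>q'\<close> in \<open>r\<close>: both are of order \<open>\<epsilon>\<close> and agree up to \<open>\<epsilon>\<^sup>2\<close>
with \<open>\<epsilon> f\<close> and \<open>\<epsilon> f'\<close>.\<close>
lemma quotient_estimates:
  fixes f g f' g' \<epsilon> K :: real
  assumes b: "\<bar>f\<bar> \<le> K" "\<bar>g\<bar> \<le> K" "\<bar>f'\<bar> \<le> K" "\<bar>g'\<bar> \<le> K" and \<epsilon>: "0 < \<epsilon>" "\<epsilon> * K \<le> 1/2"
  defines "q \<equiv> \<epsilon> * f / (1 + \<epsilon> * g)"
    and "q' \<equiv> (\<epsilon> * f' * (1 + \<epsilon> * g) - \<epsilon> * f * (\<epsilon> * g')) / ((1 + \<epsilon> * g) * (1 + \<epsilon> * g))"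
  shows "1/2 \<le> 1 + \<epsilon> * g" "1 + \<epsilon> * g \<le> 3/2" "\<bar>q\<bar> \<le> 2 * \<epsilon> * K" "\<bar>q - \<epsilon> * f\<bar> \<le> 2 * \<epsilon>\<^sup>2 * K\<^sup>2"
    "\<bar>q'\<bar> \<le> 4 * \<epsilon> * K" "\<bar>q' - \<epsilon> * f'\<bar> \<le> 6 * \<epsilon>\<^sup>2 * K\<^sup>2"
proof -
  have K: "0 \<le> K" using b(1) by linarith
  define i where "i = 1 / (1 + \<epsilon> * g)"
  have eb: "\<bar>\<epsilon> * y\<bar> \<le> \<epsilon> * K" if "\<bar>y\<bar> \<le> K" for y
    using \<epsilon>(1) that by (simp add: abs_mult)
  show lo: "1/2 \<le> 1 + \<epsilon> * g" and "1 + \<epsilon> * g \<le> 3/2" using eb[OF b(2)] \<epsilon>(2) by argo+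
  then have i: "\<bar>i\<bar> \<le> 2" "i * (1 + \<epsilon> * g) = 1" by (simp_all add: i_def field_simps)
  have prod: "\<bar>\<epsilon> * y * (\<epsilon> * y')\<bar> \<le> (\<epsilon> * K) * (\<epsilon> * K)" if "\<bar>y\<bar> \<le> K" "\<bar>y'\<bar> \<le> K" for y y'
    unfolding abs_mult[of "\<epsilon> * y"] using eb[OF that(1)] eb[OF that(2)] \<epsilon>(1) K by (intro mult_mono) auto
  have q: "q = \<epsilon> * f * i" by (simp add: q_def i_def)
  have q': "q' = \<epsilon> * f' * i - \<epsilon> * f * (\<epsilon> * g') * i * i"
  proof -
    have "(A * b - C) / (b * b) = A * (1 / b) - C * (1 / b) * (1 / b)" if "b \<noteq> 0" for A b C :: real
      using that by (simp add: field_simps)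
    then show ?thesis using lo unfolding q'_def i_def by simp
  qed
  show "\<bar>q\<bar> \<le> 2 * \<epsilon> * K"
    using mult_mono[OF eb[OF b(1)] i(1)] \<epsilon>(1) K by (simp add: q abs_mult[of _ i])
  have t1: "\<bar>\<epsilon> * y * i - \<epsilon> * y\<bar> \<le> 2 * \<epsilon>\<^sup>2 * K\<^sup>2" if "\<bar>y\<bar> \<le> K" for y
  proof -
    have "\<epsilon> * y * i - \<epsilon> * y = - (\<epsilon> * y * (\<epsilon> * g) * i)"
      using i(2) by algebra
    then have "\<bar>\<epsilon> * y * i - \<epsilon> * y\<bar> = \<bar>\<epsilon> * y * (\<epsilon> * g)\<bar> * \<bar>i\<bar>" by (simp add: abs_mult)
    also have "\<dots> \<le> (\<epsilon> * K) * (\<epsilon> * K) * 2" using \<epsilon>(1) K by (intro mult_mono prod that b i) auto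
    finally show ?thesis by (simp add: power2_eq_square mult_ac)
  qed
  then show "\<bar>q - \<epsilon> * f\<bar> \<le> 2 * \<epsilon>\<^sup>2 * K\<^sup>2" using b(1) by (simp add: q)
  have t2: "\<bar>\<epsilon> * f * (\<epsilon> * g') * i * i\<bar> \<le> 4 * \<epsilon>\<^sup>2 * K\<^sup>2"
  proof -
    have "\<bar>\<epsilon> * f * (\<epsilon> * g') * i * i\<bar> = \<bar>\<epsilon> * f * (\<epsilon> * g')\<bar> * \<bar>i\<bar> * \<bar>i\<bar>" by (simp add: abs_mult)
    also have "\<dots> \<le> (\<epsilon> * K) * (\<epsilon> * K) * 2 * 2" using \<epsilon>(1) K by (intro mult_mono prod b i) auto
    finally show ?thesis by (simp add: power2_eq_square mult_ac)
  qed
  show "\<bar>q' - \<epsilon> * f'\<bar> \<le> 6 * \<epsilon>\<^sup>2 * K\<^sup>2" unfolding q' using t1[OF b(3)] t2 by linarith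
  have "4 * \<epsilon>\<^sup>2 * K\<^sup>2 = 4 * ((\<epsilon> * K) * (\<epsilon> * K))" by (simp add: power2_eq_square)
  also have "\<dots> \<le> 4 * ((\<epsilon> * K) * (1/2))" using \<epsilon> K by (intro mult_left_mono) auto
  finally have "4 * \<epsilon>\<^sup>2 * K\<^sup>2 \<le> 2 * \<epsilon> * K" by simp
  moreover have "\<bar>\<epsilon> * f' * i\<bar> \<le> 2 * \<epsilon> * K"
    using mult_mono[OF eb[OF b(3)] i(1)] \<epsilon>(1) K by (simp add: abs_mult[of _ i])
  ultimately show "\<bar>q'\<bar> \<le> 4 * \<epsilon> * K" unfolding q' using t2 by linarith
qed

lemma eventually_small:
  fixes C k :: real
  assumes "0 < k"
  shows "\<forall>\<^sub>F \<epsilon> in at_right 0. \<epsilon> * C \<le> k"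
proof -
  have "((\<lambda>\<epsilon>. \<epsilon> * C) \<longlongrightarrow> 0 * C) (at_right 0)" by (intro tendsto_intros)
  then have "\<forall>\<^sub>F \<epsilon> in at_right 0. \<epsilon> * C < k" using assms by (intro order_tendstoD(2)) auto
  then show ?thesis by eventually_elim simp
qed

lemma integral_difference_bound:
  fixes f :: "real \<Rightarrow> real"
  assumes "continuous_on {0..2*pi} f" "continuous_on {0..2*pi} g"
    and "\<And>x. x \<in> {0..2*pi} \<Longrightarrow> \<bar>f x - g x\<bar> \<le> k"
  shows "\<bar>integral {0..2*pi} f - integral {0..2*pi} g\<bar> \<le> 2 * pi * k"
proof -
  have "norm (integral {0..2*pi} (\<lambda>x. f x - g x)) \<le> k * (2*pi - 0)"
    using assms by (intro integral_bound continuous_on_diff) auto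
  then show ?thesis
    using assms(1,2) by (simp add: integral_diff integrable_continuous_interval mult.commute)
qed

text \<open>Over one turn \<open>r\<close> moves only by \<open>O(\<epsilon>)\<close>. To first order the displacement of the return map is therefore \<open>\<epsilon>\<close> times
the integral \<open>q(\<rho>)\<close> of \<open>F \<rho>\<close>, which changes sign at the simple zero \<open>z\<close>; the intermediate value theorem
gives a fixed point. The derivative of the return map there is the exponential of the integral of the
derived slope, that is, of \<open>\<epsilon> q'(z)\<close> up to a smaller error, and so is not \<open>1\<close>. The number \<open>\<eta>\<close> is chosen so
small that \<open>F\<close> is almost linear in \<open>r\<close> for \<open>\<bar>r - z\<bar> \<le> 3 \<eta>\<close>; the fixed point lies within \<open>\<eta>\<close>, its orbit
within \<open>2 \<eta>\<close>, and the annulus leaves another \<open>\<eta>\<close> as margin.\<close>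
theorem averaging:
  fixes F G F' G' :: "real \<Rightarrow> real \<Rightarrow> real" and X :: "real \<Rightarrow> vector_field"
  assumes Fc: "continuous_on UNIV (\<lambda>p. F (fst p) (snd p))" and Gc: "continuous_on UNIV (\<lambda>p. G (fst p) (snd p))"
    and F'c: "continuous_on UNIV (\<lambda>p. F' (fst p) (snd p))" and G'c: "continuous_on UNIV (\<lambda>p. G' (fst p) (snd p))"
    and F': "\<And>r x. ((\<lambda>r. F r x) has_real_derivative F' r x) (at r)"
    and G': "\<And>r x. ((\<lambda>r. G r x) has_real_derivative G' r x) (at r)"
    and F_per: "\<And>r x. F r (x + 2*pi) = F r x" and G_per: "\<And>r x. G r (x + 2*pi) = G r x"
    and Xc: "\<And>\<epsilon>. continuous_on UNIV (X \<epsilon>)"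
    and X: "\<And>\<epsilon> r x. X \<epsilon> (pol r x) =
       (exp r * (\<epsilon> * F r x * cos x - (1 + \<epsilon> * G r x) * sin x),
        exp r * (\<epsilon> * F r x * sin x + (1 + \<epsilon> * G r x) * cos x))"
    and zero: "integral {0..2*pi} (F z) = 0" and simple_zero: "integral {0..2*pi} (F' z) \<noteq> 0" and w: "0 < w"
  shows "\<forall>\<^sub>F \<epsilon> in at_right 0. \<exists>\<gamma>. hyperbolic_limit_cycle (X \<epsilon>) \<gamma> \<and>
    \<gamma> \<subseteq> {p. exp (z - w) < norm p \<and> norm p < exp (z + w)}"
proof -
  define J where "J = integral {0..2*pi} (F' z)"
  define \<kappa> where "\<kappa> = \<bar>J\<bar>"
  have \<kappa>: "0 < \<kappa>" using simple_zero by (simp add: \<kappa>_def J_def)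
  \<comment> \<open>Two errors of size \<open>e1\<close> integrate over a turn to half of \<open>\<kappa>\<close>, which leaves the sign of \<open>J\<close> decisive.\<close>
  define e1 where "e1 = \<kappa> / (8 * pi)"
  have e1: "0 < e1" "2 * pi * (2 * e1) = \<kappa> / 2" using \<kappa> by (simp_all add: e1_def)
  have sub: "continuous_on A (\<lambda>p. F' (fst p) (snd p))" for A using F'c continuous_on_subset by blast
  obtain \<eta>0 where \<eta>0: "0 < \<eta>0"
    "\<And>r s x. r \<in> {z-w..z+w} \<Longrightarrow> s \<in> {z-w..z+w} \<Longrightarrow> x \<in> {0..2*pi} \<Longrightarrow> \<bar>r - s\<bar> < \<eta>0 \<Longrightarrow> \<bar>F' r x - F' s x\<bar> \<le> e1"
    "\<And>r s x. r \<in> {z-w..z+w} \<Longrightarrow> s \<in> {z-w..z+w} \<Longrightarrow> x \<in> {0..2*pi} \<Longrightarrow> \<bar>r - s\<bar> < \<eta>0 \<Longrightarrow>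
       \<bar>F r x - F s x - F' s x * (r - s)\<bar> \<le> e1 * \<bar>r - s\<bar>"
    by (rule uniform_linearization[of "z-w" "z+w" 0 "2*pi" F F' e1])
      (use F' sub e1 in \<open>auto intro: has_field_derivative_at_within\<close>)
  define \<eta> where "\<eta> = min \<eta>0 w / 4"
  have \<eta>: "0 < \<eta>" "3 * \<eta> < \<eta>0" "3 * \<eta> < w" using \<eta>0(1) w by (auto simp: \<eta>_def)
  define c d where "c = z - 3 * \<eta>" and "d = z + 3 * \<eta>"
  have cd: "c < d" using \<eta> by (simp add: c_def d_def)
  have cdw: "r \<in> {z-w..z+w}" if "r \<in> {c..d}" for r using that \<eta> by (auto simp: c_def d_def)
  have F'_per: "F' r (x + 2*pi) = F' r x" and G'_per: "G' r (x + 2*pi) = G' r x" for r x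
    using DERIV_unique[OF F'[of "x + 2*pi" r]] F'[of x r] DERIV_unique[OF G'[of "x + 2*pi" r]] G'[of x r]
    by (simp_all add: F_per G_per)
  obtain K1 where K1: "\<And>r x. r \<in> {c..d} \<Longrightarrow> \<bar>F r x\<bar> \<le> K1" using periodic_bounded[OF Fc F_per] by metis
  obtain K2 where K2: "\<And>r x. r \<in> {c..d} \<Longrightarrow> \<bar>G r x\<bar> \<le> K2" using periodic_bounded[OF Gc G_per] by metis
  obtain K3 where K3: "\<And>r x. r \<in> {c..d} \<Longrightarrow> \<bar>F' r x\<bar> \<le> K3" using periodic_bounded[OF F'c F'_per] by metis
  obtain K4 where K4: "\<And>r x. r \<in> {c..d} \<Longrightarrow> \<bar>G' r x\<bar> \<le> K4" using periodic_bounded[OF G'c G'_per] by metis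
  define K where "K = max (max K1 K2) (max K3 K4)"
  have K: "\<bar>F r x\<bar> \<le> K" "\<bar>G r x\<bar> \<le> K" "\<bar>F' r x\<bar> \<le> K" "\<bar>G' r x\<bar> \<le> K" if "r \<in> {c..d}" for r x
    using K1[OF that, of x] K2[OF that, of x] K3[OF that, of x] K4[OF that, of x] by (auto simp: K_def)
  have K0: "0 \<le> K" using order_trans[OF abs_ge_zero K(1)[of c 0]] cd by simp
  \<comment> \<open>The slope is frozen outside \<open>[c, d]\<close>, which keeps it globally bounded and Lipschitz.\<close>
  define cl where "cl r = max c (min d r)" for r
  have cl: "cl r \<in> {c..d}" for r using cd by (auto simp: cl_def)
  have clid: "cl r = r" if "r \<in> {c..d}" for r using that by (auto simp: cl_def)
  have cllip: "\<bar>cl r - cl s\<bar> \<le> \<bar>r - s\<bar>" for r s by (auto simp: cl_def)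
  \<comment> \<open>In this order: the slope is slow; a turn moves \<open>r\<close> by at most \<open>\<eta>\<close>; the angular speed lies between \<open>1/2\<close> and \<open>3/2\<close>;
the errors of second order in the displacement and in the derivative are below those of the linearization.\<close>
  have small: "\<forall>\<^sub>F \<epsilon> in at_right 0. 0 < \<epsilon> \<and> \<epsilon> * (32 * pi * K) \<le> 1 \<and> \<epsilon> * (4 * pi * K) \<le> \<eta> \<and>
      \<epsilon> * K \<le> 1/2 \<and> \<epsilon> * (K\<^sup>2 * (2 + 4 * pi)) \<le> \<eta> * e1 \<and> \<epsilon> * (6 * K\<^sup>2) \<le> e1"
    by (intro eventually_conj eventually_small) (use \<eta> e1 in \<open>auto simp: eventually_at_right_less\<close>)
  then show ?thesis
  proof eventually_elim
    case (elim \<epsilon>)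
    then have \<epsilon>: "0 < \<epsilon>" "\<epsilon> * K \<le> 1/2" by auto
    define s where "s r x = \<epsilon> * F r x / (1 + \<epsilon> * G r x)" for r x
    define s' where "s' r x = (\<epsilon> * F' r x * (1 + \<epsilon> * G r x) - \<epsilon> * F r x * (\<epsilon> * G' r x))
        / ((1 + \<epsilon> * G r x) * (1 + \<epsilon> * G r x))" for r x
    have est: "1/2 \<le> 1 + \<epsilon> * G r x" "1 + \<epsilon> * G r x \<le> 3/2" "\<bar>s r x\<bar> \<le> 2 * \<epsilon> * K"
      "\<bar>s r x - \<epsilon> * F r x\<bar> \<le> 2 * \<epsilon>\<^sup>2 * K\<^sup>2" "\<bar>s' r x\<bar> \<le> 4 * \<epsilon> * K"
      "\<bar>s' r x - \<epsilon> * F' r x\<bar> \<le> 6 * \<epsilon>\<^sup>2 * K\<^sup>2" if r: "r \<in> {c..d}" for r x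
      unfolding s_def s'_def
      by (rule quotient_estimates[OF K(1)[OF r] K(2)[OF r] K(3)[OF r] K(4)[OF r] \<epsilon>])+
    have nz: "1 + \<epsilon> * G r x \<noteq> 0" if "r \<in> {c..d}" for r x using est(1)[OF that, of x] by auto
    have s_deriv: "((\<lambda>r. s r x) has_real_derivative s' r x) (at r)" if "r \<in> {c..d}" for r x
      unfolding s_def s'_def
      by (rule DERIV_divide DERIV_cmult F' DERIV_cong[OF DERIV_add[OF DERIV_const DERIV_cmult[OF G']]]
          nz[OF that] add_0)+
    define S where "S r x = s (cl r) x" for r x
    have S_eq: "S r x = s r x" if "r \<in> {c..d}" for r x by (simp add: S_def clid[OF that])
    define B where "B r x = 1 + \<epsilon> * G (cl r) x" for r x
    have comp: "continuous_on A (\<lambda>p. f (g p) (h p))"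
      if "continuous_on UNIV (\<lambda>p. f (fst p) (snd p))" "continuous_on A g" "continuous_on A h"
      for f :: "real \<Rightarrow> real \<Rightarrow> real" and A :: "'b::topological_space set" and g h
      using continuous_on_compose2[OF that(1) continuous_on_Pair[OF that(2,3)]] by simp
    have s'c: "continuous_on ({c..d} \<times> {0..2*pi}) (\<lambda>p. s' (fst p) (snd p))"
      unfolding s'_def
      by (intro continuous_on_divide continuous_on_mult continuous_on_diff continuous_on_add continuous_on_const
          comp[OF Fc] comp[OF Gc] comp[OF F'c] comp[OF G'c] continuous_on_fst continuous_on_snd continuous_on_id)
        (use nz in auto)
    have clc: "continuous_on A (\<lambda>p. cl (fst p))" for A :: "(real \<times> real) set"
      unfolding cl_def by (intro continuous_intros)
    have Bc: "continuous_on UNIV (\<lambda>p. B (fst p) (snd p))"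
      unfolding B_def by (intro continuous_on_mult continuous_on_add continuous_on_const comp[OF Gc] clc
          continuous_on_snd continuous_on_id)
    have Sc: "continuous_on UNIV (\<lambda>p. S (fst p) (snd p))"
      unfolding S_def s_def
      by (intro continuous_on_divide continuous_on_mult continuous_on_add continuous_on_const
          comp[OF Fc] comp[OF Gc] clc continuous_on_snd continuous_on_id) (use nz cl in auto)
    define L M where "L = 4 * \<epsilon> * K" and "M = 2 * \<epsilon> * K"
    have S_lip: "\<bar>S r x - S t x\<bar> \<le> L * \<bar>r - t\<bar>" for r t x
    proof -
      have "norm (s (cl r) x - s (cl t) x) \<le> L * norm (cl r - cl t)"
        by (rule field_differentiable_bound[of "{c..d}" _ "\<lambda>r. s' r x"])
          (use cl est(5) in \<open>auto simp: L_def intro!: has_field_derivative_at_within[OF s_deriv]\<close>)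
      also have "\<dots> \<le> L * \<bar>r - t\<bar>" using cllip[of r t] \<epsilon> K0 by (intro mult_left_mono) (auto simp: L_def)
      finally show ?thesis by (simp add: S_def)
    qed
    interpret polar_flow S L M "X \<epsilon>" B c d
    proof
      show "\<bar>S r x\<bar> \<le> M" for r x unfolding S_def M_def by (intro est cl)
      show "2 * pi * L \<le> 1/4" using elim by (simp add: L_def mult_ac)
      show "1/2 \<le> B r x" "B r x \<le> 3/2" for r x unfolding B_def by (intro est cl)+
      show "X \<epsilon> (pol r x) = (exp r * (S r x * B r x * cos x - B r x * sin x),
         exp r * (S r x * B r x * sin x + B r x * cos x))" if "r \<in> {c..d}" for r x
      proof -
        have "S r x * B r x = \<epsilon> * F r x" using nz[OF that] by (simp add: S_def B_def s_def clid[OF that])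
        then show ?thesis by (simp add: X B_def clid[OF that])
      qed
    qed (use Sc S_lip Xc Bc in \<open>auto simp: S_def s_def B_def F_per G_per\<close>)
    have stay: "\<bar>flow \<rho> x - \<rho>\<bar> \<le> \<eta>" if "x \<in> {0..2*pi}" for \<rho> x
      using flow_near_start[OF that, of \<rho>] elim by (simp add: M_def mult_ac)
    have displacement: "\<bar>(flow \<rho> (2*pi) - \<rho>) - \<epsilon> * (\<rho> - z) * J\<bar> \<le> \<epsilon> * \<eta> * \<kappa> / 2"
      if \<rho>: "\<bar>\<rho> - z\<bar> = \<eta>" for \<rho>
    proof -
      have "((\<lambda>x. S (flow \<rho> x) x) has_integral (flow \<rho> (2*pi) - flow \<rho> 0)) {0..2*pi}"
        by (rule fundamental_theorem_of_calculus)
          (auto simp: has_real_derivative_iff_has_vector_derivative[symmetric] intro: flow_deriv)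
      then have 1: "integral {0..2*pi} (\<lambda>x. S (flow \<rho> x) x) = flow \<rho> (2*pi) - \<rho>"
        by (simp add: integral_unique)
      have Fz: "continuous_on {0..2*pi} (F z)" and F'z: "continuous_on {0..2*pi} (F' z)"
        by (intro comp[OF Fc] comp[OF F'c] continuous_on_const continuous_on_id)+
      have "integral {0..2*pi} (\<lambda>x. \<epsilon> * (F z x + (\<rho> - z) * F' z x))
          = \<epsilon> * (integral {0..2*pi} (F z) + (\<rho> - z) * J)"
        using integrable_continuous_interval[OF Fz] integrable_continuous_interval[OF F'z]
        by (simp add: J_def integral_add integrable_on_mult_right)
      then have 2: "integral {0..2*pi} (\<lambda>x. \<epsilon> * (F z x + (\<rho> - z) * F' z x)) = \<epsilon> * (\<rho> - z) * J"
        by (simp add: zero)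
      have zin: "z \<in> {c..d}" using \<eta> by (simp add: c_def d_def)
      have "c \<le> \<rho>" "\<rho> \<le> d" using \<rho> \<eta>(1) unfolding c_def d_def by argo+
      then have \<rho>in: "\<rho> \<in> {c..d}" by simp
      have "\<bar>integral {0..2*pi} (\<lambda>x. S (flow \<rho> x) x) - integral {0..2*pi} (\<lambda>x. \<epsilon> * (F z x + (\<rho> - z) * F' z x))\<bar>
          \<le> 2 * pi * (\<epsilon> * (2 * (\<eta> * e1)))"
      proof (rule integral_difference_bound)
        show "continuous_on {0..2*pi} (\<lambda>x. S (flow \<rho> x) x)"
          by (intro S_cont_comp flow_continuous continuous_on_id)
        show "continuous_on {0..2*pi} (\<lambda>x. \<epsilon> * (F z x + (\<rho> - z) * F' z x))"
          by (intro continuous_intros Fz F'z)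
        fix x assume x: "x \<in> {0..2*pi}"
        let ?R = "flow \<rho> x"
        have "c \<le> ?R" "?R \<le> d" using stay[OF x, of \<rho>] \<rho> \<eta>(1) unfolding c_def d_def by argo+
        then have Rin: "?R \<in> {c..d}" by simp
        have a: "\<bar>S ?R x - \<epsilon> * F ?R x\<bar> \<le> 2 * \<epsilon>\<^sup>2 * K\<^sup>2"
          unfolding S_eq[OF Rin] by (rule est(4)[OF Rin])
        have "norm (F ?R x - F \<rho> x) \<le> K * norm (?R - \<rho>)"
          by (rule field_differentiable_bound[of "{c..d}" _ "\<lambda>r. F' r x"])
            (use Rin \<rho>in K in \<open>auto intro: has_field_derivative_at_within F'\<close>)
        also have "\<dots> \<le> K * (2 * pi * M)" using flow_near_start[OF x, of \<rho>] K0 by (intro mult_left_mono) auto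
        also have "\<dots> = \<epsilon> * K\<^sup>2 * (4 * pi)" by (simp add: M_def power2_eq_square)
        finally have "\<epsilon> * \<bar>F ?R x - F \<rho> x\<bar> \<le> \<epsilon> * (\<epsilon> * K\<^sup>2 * (4 * pi))" using \<epsilon> by (intro mult_left_mono) auto
        then have b: "\<bar>\<epsilon> * F ?R x - \<epsilon> * F \<rho> x\<bar> \<le> \<epsilon> * (\<epsilon> * K\<^sup>2 * (4 * pi))"
          using \<epsilon> by (simp add: right_diff_distrib[symmetric] abs_mult)
        have "\<bar>F \<rho> x - F z x - F' z x * (\<rho> - z)\<bar> \<le> e1 * \<bar>\<rho> - z\<bar>"
          using \<rho> \<eta> by (intro \<eta>0 cdw \<rho>in zin x) auto
        then have "\<epsilon> * \<bar>F \<rho> x - F z x - F' z x * (\<rho> - z)\<bar> \<le> \<epsilon> * (\<eta> * e1)" 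
          using \<epsilon> \<rho> by (intro mult_left_mono) (auto simp: mult.commute)
        moreover have "\<epsilon> * F \<rho> x - \<epsilon> * (F z x + (\<rho> - z) * F' z x) = \<epsilon> * (F \<rho> x - F z x - F' z x * (\<rho> - z))"
          by (simp add: algebra_simps)
        ultimately have c: "\<bar>\<epsilon> * F \<rho> x - \<epsilon> * (F z x + (\<rho> - z) * F' z x)\<bar> \<le> \<epsilon> * (\<eta> * e1)"
          using \<epsilon> by (simp add: abs_mult)
        have "\<epsilon> * (\<epsilon> * (K\<^sup>2 * (2 + 4 * pi))) \<le> \<epsilon> * (\<eta> * e1)" using elim \<epsilon> by (intro mult_left_mono) auto
        then have d: "2 * \<epsilon>\<^sup>2 * K\<^sup>2 + \<epsilon> * (\<epsilon> * K\<^sup>2 * (4 * pi)) \<le> \<epsilon> * (\<eta> * e1)"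
          by (simp add: power2_eq_square algebra_simps)
        show "\<bar>S ?R x - \<epsilon> * (F z x + (\<rho> - z) * F' z x)\<bar> \<le> \<epsilon> * (2 * (\<eta> * e1))"
          using a b c d by (simp only: distrib_left mult.left_commute[of \<epsilon> 2])
      qed
      also have "2 * pi * (\<epsilon> * (2 * (\<eta> * e1))) = \<epsilon> * \<eta> * (2 * pi * (2 * e1))" by simp
      also have "\<dots> = \<epsilon> * \<eta> * \<kappa> / 2" unfolding e1(2) by simp
      finally show ?thesis unfolding 1 2 .
    qed
    \<comment> \<open>Multiplying the displacement by \<open>J\<close> makes it negative at \<open>z - \<eta>\<close> and positive at \<open>z + \<eta>\<close>, whatever
the sign of \<open>J\<close>.\<close>
    have pc: "continuous_on A (\<lambda>\<rho>. J * (flow \<rho> (2*pi) - \<rho>))" for A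
    proof -
      have "continuous_on A (\<lambda>\<rho>. (\<rho>, 2*pi))" by (intro continuous_intros)
      from continuous_on_compose2[OF flow_jointly_continuous this]
      have "continuous_on A (\<lambda>\<rho>. flow \<rho> (2*pi))" by (simp add: image_subset_iff)
      then show ?thesis by (intro continuous_intros)
    qed
    have JJ: "J * J = \<kappa> * \<kappa>" by (simp add: \<kappa>_def)
    have sign: "\<bar>J * (flow \<rho> (2*pi) - \<rho>) - \<epsilon> * (\<rho> - z) * (\<kappa> * \<kappa>)\<bar> \<le> \<epsilon> * \<eta> * (\<kappa> * \<kappa>) / 2"
      if "\<bar>\<rho> - z\<bar> = \<eta>" for \<rho>
    proof -
      have "J * (flow \<rho> (2*pi) - \<rho>) - \<epsilon> * (\<rho> - z) * (\<kappa> * \<kappa>) = J * ((flow \<rho> (2*pi) - \<rho>) - \<epsilon> * (\<rho> - z) * J)"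
        unfolding JJ[symmetric] by (simp add: algebra_simps)
      then have "\<bar>J * (flow \<rho> (2*pi) - \<rho>) - \<epsilon> * (\<rho> - z) * (\<kappa> * \<kappa>)\<bar> = \<kappa> * \<bar>(flow \<rho> (2*pi) - \<rho>) - \<epsilon> * (\<rho> - z) * J\<bar>"
        by (simp add: \<kappa>_def abs_mult)
      also have "\<dots> \<le> \<kappa> * (\<epsilon> * \<eta> * \<kappa> / 2)" using displacement[OF that] \<kappa> by (intro mult_left_mono) auto
      finally show ?thesis by (simp add: mult_ac)
    qed
    have pos: "0 < \<epsilon> * \<eta> * (\<kappa> * \<kappa>)" using \<epsilon> \<eta> \<kappa> by simp
    have ends: "\<epsilon> * (z - \<eta> - z) * (\<kappa> * \<kappa>) = - (\<epsilon> * \<eta> * (\<kappa> * \<kappa>))"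
      "\<epsilon> * (z + \<eta> - z) * (\<kappa> * \<kappa>) = \<epsilon> * \<eta> * (\<kappa> * \<kappa>)" "\<bar>z - \<eta> - z\<bar> = \<eta>" "\<bar>z + \<eta> - z\<bar> = \<eta>"
      using \<eta>(1) by simp_all
    have "J * (flow (z - \<eta>) (2*pi) - (z - \<eta>)) \<le> 0"
      using sign[OF ends(3)] pos unfolding ends(1) by argo
    moreover have "0 \<le> J * (flow (z + \<eta>) (2*pi) - (z + \<eta>))"
      using sign[OF ends(4)] pos unfolding ends(2) by argo
    ultimately obtain \<rho> where \<rho>: "z - \<eta> \<le> \<rho>" "\<rho> \<le> z + \<eta>" "J * (flow \<rho> (2*pi) - \<rho>) = 0"
      using IVT'[of "\<lambda>\<rho>. J * (flow \<rho> (2*pi) - \<rho>)" "z - \<eta>" 0 "z + \<eta>"] pc \<eta> by auto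
    then have fp: "flow \<rho> (2*pi) = \<rho>" using simple_zero by (simp add: J_def)
    have near: "z - 2 * \<eta> \<le> flow \<rho> x \<and> flow \<rho> x \<le> z + 2 * \<eta>" if "x \<in> {0..2*pi}" for x
      using stay[OF that, of \<rho>] \<rho> by auto
    have in_cd: "flow \<rho> x \<in> {c..d}" if "x \<in> {0..2*pi}" for x using near[OF that] \<eta> by (auto simp: c_def d_def)
    define Q where "Q x = s' (flow \<rho> x) x" for x
    have Qc: "continuous_on {0..2*pi} Q"
      unfolding Q_def
      using continuous_on_compose2[OF s'c continuous_on_Pair[OF flow_continuous continuous_on_id]] in_cd by force
    have ret: "((\<lambda>\<sigma>. flow \<sigma> (2*pi)) has_real_derivative exp (integral {0..2*pi} Q)) (at \<rho>)"
    proof (rule return_derivative[OF Qc])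
      fix e :: real assume e: "0 < e"
      obtain \<delta> where \<delta>: "0 < \<delta>" "\<And>r t x. r \<in> {c..d} \<Longrightarrow> t \<in> {c..d} \<Longrightarrow> x \<in> {0..2*pi} \<Longrightarrow> \<bar>r - t\<bar> < \<delta> \<Longrightarrow>
         \<bar>s r x - s t x - s' t x * (r - t)\<bar> \<le> e * \<bar>r - t\<bar>"
        by (rule uniform_linearization[of c d 0 "2*pi" s s' e])
          (use s_deriv s'c e in \<open>auto intro: has_field_derivative_at_within\<close>)
      show "\<exists>\<delta>>0. \<forall>x\<in>{0..2*pi}. \<forall>r. \<bar>r - flow \<rho> x\<bar> < \<delta> \<longrightarrow>
         \<bar>S r x - S (flow \<rho> x) x - Q x * (r - flow \<rho> x)\<bar> \<le> e * \<bar>r - flow \<rho> x\<bar>"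
      proof (intro exI[of _ "min \<delta> \<eta>"] conjI ballI allI impI)
        fix x r assume x: "x \<in> {0..2*pi}" and r: "\<bar>r - flow \<rho> x\<bar> < min \<delta> \<eta>"
        have "\<bar>r - flow \<rho> x\<bar> < \<eta>" using r by simp
        then have "c \<le> r" "r \<le> d" using near[OF x] unfolding c_def d_def by argo+
        then have rin: "r \<in> {c..d}" by simp
        show "\<bar>S r x - S (flow \<rho> x) x - Q x * (r - flow \<rho> x)\<bar> \<le> e * \<bar>r - flow \<rho> x\<bar>"
          using \<delta>(2)[OF rin in_cd[OF x] x] r by (simp add: S_eq[OF rin] S_eq[OF in_cd[OF x]] Q_def)
      qed (use \<delta> \<eta> in auto)
    qed
    have "\<bar>integral {0..2*pi} Q - integral {0..2*pi} (\<lambda>x. \<epsilon> * F' z x)\<bar> \<le> 2 * pi * (\<epsilon> * (2 * e1))"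
    proof (rule integral_difference_bound[OF Qc])
      show "continuous_on {0..2*pi} (\<lambda>x. \<epsilon> * F' z x)"
        by (intro continuous_on_mult comp[OF F'c] continuous_on_const continuous_on_id)
      fix x assume x: "x \<in> {0..2*pi}"
      note R = in_cd[OF x]
      have 1: "\<bar>Q x - \<epsilon> * F' (flow \<rho> x) x\<bar> \<le> 6 * \<epsilon>\<^sup>2 * K\<^sup>2" unfolding Q_def by (intro est R)
      have zin: "z \<in> {c..d}" using \<eta> by (auto simp: c_def d_def)
      have "\<bar>F' (flow \<rho> x) x - F' z x\<bar> \<le> e1" using near[OF x] \<eta> by (intro \<eta>0 cdw R zin x) auto
      then have "\<epsilon> * \<bar>F' (flow \<rho> x) x - F' z x\<bar> \<le> \<epsilon> * e1" using \<epsilon> by (intro mult_left_mono) auto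
      then have 2: "\<bar>\<epsilon> * F' (flow \<rho> x) x - \<epsilon> * F' z x\<bar> \<le> \<epsilon> * e1"
        using \<epsilon> by (simp add: right_diff_distrib[symmetric] abs_mult)
      have "\<epsilon> * (\<epsilon> * (6 * K\<^sup>2)) \<le> \<epsilon> * e1" using elim \<epsilon> by (intro mult_left_mono) auto
      then have 3: "6 * \<epsilon>\<^sup>2 * K\<^sup>2 \<le> \<epsilon> * e1" by (simp add: power2_eq_square mult_ac)
      show "\<bar>Q x - \<epsilon> * F' z x\<bar> \<le> \<epsilon> * (2 * e1)" using 1 2 3 by linarith
    qed
    also have "2 * pi * (\<epsilon> * (2 * e1)) = \<epsilon> * (2 * pi * (2 * e1))" by simp
    also have "\<dots> = \<epsilon> * \<kappa> / 2" unfolding e1(2) by simp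
    finally have "\<bar>integral {0..2*pi} Q - \<epsilon> * J\<bar> \<le> \<epsilon> * \<kappa> / 2" by (simp add: J_def)
    moreover have "\<bar>\<epsilon> * J\<bar> = \<epsilon> * \<kappa>" "0 < \<epsilon> * \<kappa>" using \<epsilon> \<kappa> by (simp_all add: \<kappa>_def abs_mult)
    ultimately have "integral {0..2*pi} Q \<noteq> 0" by auto
    then have hyp: "\<bar>exp (integral {0..2*pi} Q)\<bar> \<noteq> 1" by simp
    interpret closed_turn S L M "X \<epsilon>" B c d \<rho> \<eta> "exp (integral {0..2*pi} Q)"
    proof
      show "c + \<eta> \<le> flow \<rho> x \<and> flow \<rho> x \<le> d - \<eta>" if "x \<in> {0..2*pi}" for x
        using near[OF that] by (simp add: c_def d_def)
    qed (rule \<eta>(1) fp ret hyp)+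
    have "exp (z - w) < exp c" "exp d < exp (z + w)" using \<eta> by (simp_all add: c_def d_def)
    then have "cycle \<subseteq> {p. exp (z - w) < norm p \<and> norm p < exp (z + w)}"
      using conjunct2[OF hyperbolic_cycle] less_trans by blast
    then show ?case using hyperbolic_cycle by blast
  qed
qed

section \<open>Simple zeros of exponential sums\<close>

text \<open>Fewer homogeneous linear equations than unknowns; Gaussian elimination of one unknown per point.\<close>
lemma nontrivial_combination_vanishing:
  fixes f :: "'j \<Rightarrow> 'z \<Rightarrow> real"
  assumes "finite Z" "finite J" "card Z < card J"
  shows "\<exists>b. (\<exists>j\<in>J. b j \<noteq> 0) \<and> (\<forall>z\<in>Z. (\<Sum>j\<in>J. b j * f j z) = 0)"
  using assms
proof (induction Z arbitrary: J f rule: finite_induct)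
  case empty
  then have "J \<noteq> {}" by auto
  then show ?case by (intro exI[of _ "\<lambda>_. 1"]) auto
next
  case (insert z Z)
  show ?case
  proof (cases "\<forall>j\<in>J. f j z = 0")
    case True
    have "card Z < card J" using insert by simp
    from insert.IH[OF insert.prems(1) this, of f] True show ?thesis by auto
  next
    case False
    then obtain k where k: "k \<in> J" "f k z \<noteq> 0" by blast
    define f' where "f' j y = f j y - f j z / f k z * f k y" for j y
    have "finite (J - {k})" "card Z < card (J - {k})" using insert k by auto
    from insert.IH[OF this, of f'] obtain b where b: "\<exists>j\<in>J - {k}. b j \<noteq> 0"
      "\<forall>y\<in>Z. (\<Sum>j\<in>J - {k}. b j * f' j y) = 0" by blast
    define b' where "b' = b(k := - (\<Sum>j\<in>J - {k}. b j * (f j z / f k z)))"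
    have eq: "(\<Sum>j\<in>J. b' j * f j y) = (\<Sum>j\<in>J - {k}. b j * f' j y)" for y
    proof -
      have "(\<Sum>j\<in>J. b' j * f j y) = b' k * f k y + (\<Sum>j\<in>J - {k}. b' j * f j y)"
        by (rule sum.remove[OF insert.prems(1) k(1)])
      also have "(\<Sum>j\<in>J - {k}. b' j * f j y) = (\<Sum>j\<in>J - {k}. b j * f j y)"
        by (rule sum.cong) (auto simp: b'_def)
      also have "b' k * f k y = - (\<Sum>j\<in>J - {k}. b j * (f j z / f k z * f k y))"
        by (simp add: b'_def sum_distrib_right mult.assoc)
      finally show ?thesis by (simp add: f'_def right_diff_distrib sum_subtractf)
    qed
    have "f' j z = 0" for j using k by (simp add: f'_def)
    then have "\<forall>y\<in>insert z Z. (\<Sum>j\<in>J. b' j * f j y) = 0" using b(2) by (simp add: eq)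
    moreover have "\<exists>j\<in>J. b' j \<noteq> 0" using b(1) by (auto simp: b'_def)
    ultimately show ?thesis by blast
  qed
qed

text \<open>Zeros of the derivative are picked strictly between consecutive zeros of \<open>g\<close>. They avoid the zeros of \<open>g\<close>,
so that a multiple zero of \<open>g\<close> counts as a further zero of the derivative.\<close>
lemma rolle_zeros:
  fixes g g' :: "real \<Rightarrow> real"
  assumes g': "\<And>x. (g has_real_derivative g' x) (at x)" and Z: "finite Z" "\<And>z. z \<in> Z \<Longrightarrow> g z = 0"
  obtains Y where "finite Y" "card Z \<le> card Y + 1" "Y \<inter> Z = {}" "\<And>y. y \<in> Y \<Longrightarrow> g' y = 0"
proof -
  have "\<exists>Y. finite Y \<and> card Z \<le> card Y + 1 \<and> Y \<inter> Z = {} \<and> (\<forall>y\<in>Y. g' y = 0 \<and> (\<exists>z\<in>Z. y < z))"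
    using Z
  proof (induction Z rule: finite_linorder_max_induct)
    case empty
    then show ?case by (intro exI[of _ "{}"]) auto
  next
    case (insert b A)
    then obtain Y where Y: "finite Y" "card A \<le> card Y + 1" "Y \<inter> A = {}"
      "\<forall>y\<in>Y. g' y = 0 \<and> (\<exists>z\<in>A. y < z)" by auto
    show ?case
    proof (cases "A = {}")
      case True
      then show ?thesis by (intro exI[of _ "{}"]) auto
    next
      case False
      define m where "m = Max A"
      have m: "m \<in> A" "\<And>a. a \<in> A \<Longrightarrow> a \<le> m" using False insert.hyps by (auto simp: m_def)
      have "\<exists>y>m. y < b \<and> g' y = 0"
      proof -
        have "m < b" using m insert by auto
        moreover have "g m = g b" using m insert by simp
        moreover have "continuous_on {m..b} g"
          by (rule DERIV_continuous_on[OF has_field_derivative_at_within[OF g']])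
        ultimately obtain y where "m < y" "y < b" "(*) (g' y) = (\<lambda>v. 0)"
          using Rolle_deriv[of m b g "\<lambda>x. (*) (g' x)"] g' unfolding has_field_derivative_def by blast
        moreover from this have "g' y = 0" by (metis mult.right_neutral)
        ultimately show ?thesis by blast
      qed
      then obtain y where y: "m < y" "y < b" "g' y = 0" by blast
      have below: "x < m" if "x \<in> Y" for x using Y(4) m(2) that by fastforce
      have "y \<notin> Y" "b \<notin> Y" "y \<notin> A" using below m y insert.hyps by force+
      then show ?thesis
        using Y y insert.hyps by (intro exI[of _ "insert y Y"]) (auto simp: card_insert_if)
    qed
  qed
  then show ?thesis using that by blast
qed

definition exp_sum :: "'j set \<Rightarrow> ('j \<Rightarrow> real) \<Rightarrow> ('j \<Rightarrow> real) \<Rightarrow> real \<Rightarrow> real" where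
  "exp_sum J b \<beta> x = (\<Sum>j\<in>J. b j * exp (\<beta> j * x))"

lemma exp_sum_deriv:
  "(exp_sum J b \<beta> has_real_derivative exp_sum J (\<lambda>j. b j * \<beta> j) \<beta> x) (at x)"
  unfolding exp_sum_def[abs_def]
  by (auto intro!: derivative_eq_intros sum.cong simp: mult_ac)

text \<open>Dividing by one of the exponentials turns its term into a constant, which disappears on
differentiation: the derivative has one term less.\<close>
lemma exp_sum_factor:
  assumes "finite J" "k \<in> J"
  shows "exp_sum J b \<beta> x = exp (\<beta> k * x) * (b k + exp_sum (J - {k}) b (\<lambda>j. \<beta> j - \<beta> k) x)"
proof -
  have "exp_sum J b \<beta> x = b k * exp (\<beta> k * x) + exp_sum (J - {k}) b \<beta> x"
    unfolding exp_sum_def by (rule sum.remove[OF assms])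
  also have "exp_sum (J - {k}) b \<beta> x = exp (\<beta> k * x) * exp_sum (J - {k}) b (\<lambda>j. \<beta> j - \<beta> k) x"
    unfolding exp_sum_def sum_distrib_left
    by (rule sum.cong) (auto simp: exp_add[symmetric] mult.left_commute left_diff_distrib)
  finally show ?thesis by (simp add: algebra_simps)
qed

lemma exp_sum_card_zeros:
  assumes "finite J" "inj_on \<beta> J" "\<exists>j\<in>J. b j \<noteq> 0" "finite Z" "\<And>z. z \<in> Z \<Longrightarrow> exp_sum J b \<beta> z = 0"
  shows "card Z < card J"
  using assms
proof (induction J arbitrary: b \<beta> Z rule: finite_induct)
  case empty
  then show ?case by simp
next
  case (insert k J)
  define \<gamma> where "\<gamma> = (\<lambda>j. \<beta> j - \<beta> k)"
  define h where "h x = b k + exp_sum J b \<gamma> x" for x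
  have factor: "exp_sum (insert k J) b \<beta> x = exp (\<beta> k * x) * h x" for x
    using exp_sum_factor[of "insert k J" k b \<beta> x] insert.hyps by (simp add: h_def \<gamma>_def)
  have hz: "h z = 0" if "z \<in> Z" for z using insert.prems(4)[OF that] by (simp add: factor)
  show ?case
  proof (cases "\<exists>j\<in>J. b j \<noteq> 0")
    case False
    then have "exp_sum J b \<gamma> x = 0" for x by (simp add: exp_sum_def)
    then have "Z = {}" using hz False insert.prems(2) by (auto simp: h_def)
    then show ?thesis using insert.hyps by simp
  next
    case True
    have "(h has_real_derivative exp_sum J (\<lambda>j. b j * \<gamma> j) \<gamma> x) (at x)" for x
      unfolding h_def by (auto intro!: derivative_eq_intros exp_sum_deriv)
    from rolle_zeros[OF this insert.prems(3) hz] obtain Y where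
      Y: "finite Y" "card Z \<le> card Y + 1" "\<And>y. y \<in> Y \<Longrightarrow> exp_sum J (\<lambda>j. b j * \<gamma> j) \<gamma> y = 0"
      by metis
    have "\<gamma> j \<noteq> 0" if "j \<in> J" for j
      using insert.prems(1) insert.hyps that by (auto simp: \<gamma>_def inj_on_def)
    then have "\<exists>j\<in>J. b j * \<gamma> j \<noteq> 0" using True by auto
    moreover have "inj_on \<gamma> J" using insert.prems(1) by (auto simp: inj_on_def \<gamma>_def)
    ultimately have "card Y < card J" using insert.IH[of \<gamma> "\<lambda>j. b j * \<gamma> j" Y] Y by blast
    then show ?thesis using Y(2) insert.hyps by simp
  qed
qed

text \<open>After division by one of the exponentials a double zero is a zero of the derivative besides those of
Rolle's theorem, one too many for its number of terms.\<close>
lemma exp_sum_simple_zeros: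
  assumes J: "finite J" "inj_on \<beta> J" and nontrivial: "\<exists>j\<in>J. b j \<noteq> 0" and Z: "finite Z" "card J = card Z + 1"
    and zero: "\<And>z. z \<in> Z \<Longrightarrow> exp_sum J b \<beta> z = 0" and z: "z \<in> Z"
  shows "exp_sum J (\<lambda>j. b j * \<beta> j) \<beta> z \<noteq> 0"
proof
  assume double: "exp_sum J (\<lambda>j. b j * \<beta> j) \<beta> z = 0"
  obtain k where k: "k \<in> J" using nontrivial by blast
  define \<gamma> where "\<gamma> = (\<lambda>j. \<beta> j - \<beta> k)"
  define h where "h x = b k + exp_sum (J - {k}) b \<gamma> x" for x
  define h' where "h' x = exp_sum (J - {k}) (\<lambda>j. b j * \<gamma> j) \<gamma> x" for x
  have factor: "exp_sum J b \<beta> = (\<lambda>x. exp (\<beta> k * x) * h x)"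
    using exp_sum_factor[OF J(1) k, of b \<beta>] by (auto simp: h_def \<gamma>_def)
  have hz: "h y = 0" if "y \<in> Z" for y using zero[OF that] by (simp add: factor)
  have h': "(h has_real_derivative h' x) (at x)" for x
    unfolding h_def h'_def by (auto intro!: derivative_eq_intros exp_sum_deriv)
  have "(exp_sum J b \<beta> has_real_derivative exp (\<beta> k * z) * h' z) (at z)"
    unfolding factor using hz[OF z] by (auto intro!: derivative_eq_intros h')
  from DERIV_unique[OF this exp_sum_deriv] have "h' z = 0" using double by simp
  obtain Y where Y: "finite Y" "card Z \<le> card Y + 1" "Y \<inter> Z = {}" "\<And>y. y \<in> Y \<Longrightarrow> h' y = 0"
    using rolle_zeros[OF h' Z(1) hz] by metis
  have "card (insert z Y) < card (J - {k})"
  proof (rule exp_sum_card_zeros[where \<beta>=\<gamma> and b="\<lambda>j. b j * \<gamma> j"])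
    show "inj_on \<gamma> (J - {k})" using J(2) by (auto simp: inj_on_def \<gamma>_def)
    have "\<exists>j\<in>J - {k}. b j \<noteq> 0"
    proof (rule ccontr)
      assume *: "\<not> ?thesis"
      then have "exp_sum (J - {k}) b \<gamma> z = 0" by (simp add: exp_sum_def)
      then have "b k = 0" using hz[OF z] by (simp add: h_def)
      with * nontrivial show False by auto
    qed
    moreover have "\<gamma> j \<noteq> 0" if "j \<in> J - {k}" for j
      using J(2) k that by (auto simp: \<gamma>_def inj_on_def)
    ultimately show "\<exists>j\<in>J - {k}. b j * \<gamma> j \<noteq> 0" by auto
    show "exp_sum (J - {k}) (\<lambda>j. b j * \<gamma> j) \<gamma> y = 0" if "y \<in> insert z Y" for y
      using that Y(4) \<open>h' z = 0\<close> by (auto simp: h'_def)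
  qed (use J Y in auto)
  moreover have "z \<notin> Y" using Y(3) z by blast
  ultimately show False using Y Z k J(1) by simp
qed

section \<open>Perturbations by homogeneous fields\<close>

definition radial_part :: "vector_field \<Rightarrow> real \<Rightarrow> real" where
  "radial_part X x = fst (X (cos x, sin x)) * cos x + snd (X (cos x, sin x)) * sin x"

definition angular_part :: "vector_field \<Rightarrow> real \<Rightarrow> real" where
  "angular_part X x = snd (X (cos x, sin x)) * cos x - fst (X (cos x, sin x)) * sin x"

lemma radial_integral_eq: "radial_integral X = integral {0..2*pi} (radial_part X)"
  by (simp add: radial_integral_def radial_part_def[abs_def])

lemma polar_parts_continuous:
  assumes "continuous_on UNIV X"
  shows "continuous_on A (radial_part X)" "continuous_on A (angular_part X)"
proof -
  have "continuous_on A (\<lambda>x. X (cos x, sin x))"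
    by (rule continuous_on_compose2[OF assms]) (auto intro!: continuous_intros)
  then show "continuous_on A (radial_part X)" "continuous_on A (angular_part X)"
    unfolding radial_part_def[abs_def] angular_part_def[abs_def] by (auto intro!: continuous_intros)
qed

lemma homogeneous_polar:
  assumes "homogeneous \<alpha> X"
  shows "X (pol r x) = (exp (\<alpha> * r) * (radial_part X x * cos x - angular_part X x * sin x),
    exp (\<alpha> * r) * (radial_part X x * sin x + angular_part X x * cos x))"
proof -
  have "X (exp r * cos x, exp r * sin x) = (exp r powr \<alpha>) *\<^sub>R X (cos x, sin x)"
  proof -
    have "X (exp r * cos x, exp r * sin x) = (if exp r = 0 \<and> \<alpha> = 0 then 1 else exp r powr \<alpha>) *\<^sub>R X (cos x, sin x)"
      using assms exp_ge_zero[of r] unfolding homogeneous_def by blast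
    then show ?thesis by simp
  qed
  moreover have "exp r powr \<alpha> = exp (\<alpha> * r)" by (simp add: powr_def)
  moreover have "fst (X (cos x, sin x)) = radial_part X x * cos x - angular_part X x * sin x"
    "snd (X (cos x, sin x)) = radial_part X x * sin x + angular_part X x * cos x"
  proof -
    have id: "(a * c + b * s) * c - (b * c - a * s) * s = a * (s\<^sup>2 + c\<^sup>2)"
      "(a * c + b * s) * s + (b * c - a * s) * c = b * (s\<^sup>2 + c\<^sup>2)" for a b c s :: real
      by (simp_all add: power2_eq_square algebra_simps)
    show "fst (X (cos x, sin x)) = radial_part X x * cos x - angular_part X x * sin x"
      "snd (X (cos x, sin x)) = radial_part X x * sin x + angular_part X x * cos x"
      unfolding radial_part_def angular_part_def id by simp_all
  qed
  ultimately show ?thesis by (simp add: pol_def prod_eq_iff)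
qed

lemma exp_weighted_continuous:
  fixes c \<beta> :: "nat \<Rightarrow> real"
  assumes "\<And>j. j \<le> n \<Longrightarrow> continuous_on UNIV (\<phi> j)"
  shows "continuous_on UNIV (\<lambda>p. \<Sum>j\<le>n. c j * exp (\<beta> j * fst p) * \<phi> j (snd p :: real))"
  by (intro continuous_on_sum continuous_on_mult continuous_intros continuous_on_compose2[OF assms]) auto

lemma exp_weighted_deriv:
  fixes c \<beta> :: "nat \<Rightarrow> real"
  shows "((\<lambda>r. \<Sum>j\<le>n. c j * exp (\<beta> j * r) * \<phi> j) has_real_derivative
    (\<Sum>j\<le>n. c j * \<beta> j * exp (\<beta> j * r) * \<phi> j)) (at r)"
  by (auto intro!: derivative_eq_intros sum.cong)

lemma exp_weighted_integral:
  fixes c \<beta> :: "nat \<Rightarrow> real"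
  assumes "\<And>j. j \<le> n \<Longrightarrow> continuous_on UNIV (X j)"
  shows "integral {0..2*pi} (\<lambda>x. \<Sum>j\<le>n. c j * exp (\<beta> j * r) * radial_part (X j) x)
    = (\<Sum>j\<le>n. c j * exp (\<beta> j * r) * radial_integral (X j))"
proof -
  have "(\<lambda>x. c j * exp (\<beta> j * r) * radial_part (X j) x) integrable_on {0..2*pi}" if "j \<le> n" for j
    by (intro integrable_continuous_interval continuous_on_mult continuous_on_const
        polar_parts_continuous assms that)
  then have "integral {0..2*pi} (\<lambda>x. \<Sum>j\<le>n. c j * exp (\<beta> j * r) * radial_part (X j) x)
      = (\<Sum>j\<le>n. integral {0..2*pi} (\<lambda>x. c j * exp (\<beta> j * r) * radial_part (X j) x))"
    by (intro integral_sum) auto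
  then show ?thesis by (simp add: radial_integral_eq)
qed

text \<open>The exponential sum is made to vanish at \<open>1, \<dots>, m\<close>. Dividing its coefficients by the radial integrals gives
the \<open>c\<^sub>j\<close>, and the field \<open>X\<^sub>j\<close> is switched off when its radial integral is zero. Annuli of logarithmic
half-width \<open>1/2\<close> around these zeros are disjoint, so the cycles are distinct.\<close>
lemma many_hyperbolic_limit_cycles:
  fixes n m :: nat and \<alpha> :: "nat \<Rightarrow> real" and X :: "nat \<Rightarrow> vector_field"
  assumes \<alpha>: "\<And>i j. i < j \<Longrightarrow> j \<le> n \<Longrightarrow> \<alpha> i < \<alpha> j"
    and Xc: "\<And>j. j \<le> n \<Longrightarrow> continuous_on UNIV (X j)"
    and hom: "\<And>j. j \<le> n \<Longrightarrow> homogeneous (\<alpha> j) (X j)"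
    and card_J: "card {j. j \<le> n \<and> radial_integral (X j) \<noteq> 0} = m + 1"
  shows "\<exists>a \<Gamma>. finite \<Gamma> \<and> card \<Gamma> = m \<and> (\<forall>\<gamma>\<in>\<Gamma>. hyperbolic_limit_cycle (combined_field n X a) \<gamma>)"
proof -
  define J where "J = {j. j \<le> n \<and> radial_integral (X j) \<noteq> 0}"
  \<comment> \<open>One power of the radius is lost because \<open>r\<close> is the logarithm of the radius.\<close>
  define \<beta> where "\<beta> j = \<alpha> j - 1" for j
  define Z where "Z = real ` {1..m}"
  have J: "finite J" "card J = m + 1" using card_J by (simp_all add: J_def)
  have Z: "finite Z" "card Z = m" by (simp_all add: Z_def card_image)
  have inj: "inj_on \<beta> J"
  proof (rule linorder_inj_onI)
    fix i j assume "i < j" "i \<in> J" "j \<in> J"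
    then have "\<alpha> i < \<alpha> j" by (intro \<alpha>) (auto simp: J_def)
    then show "\<beta> i \<noteq> \<beta> j" by (simp add: \<beta>_def)
  qed auto
  obtain b where b: "\<exists>j\<in>J. b j \<noteq> 0" "\<And>z. z \<in> Z \<Longrightarrow> exp_sum J b \<beta> z = 0"
    using nontrivial_combination_vanishing[of Z J "\<lambda>j z. exp (\<beta> j * z)"] J Z
    by (auto simp: exp_sum_def)
  define c where "c j = (if j \<in> J then b j / radial_integral (X j) else 0)" for j
  have c_int: "(\<Sum>j\<le>n. c j * e j * radial_integral (X j)) = (\<Sum>j\<in>J. b j * e j)" for e
  proof -
    have "(\<Sum>j\<le>n. c j * e j * radial_integral (X j)) = (\<Sum>j\<in>J. c j * e j * radial_integral (X j))"
      by (rule sum.mono_neutral_right) (auto simp: J_def c_def)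
    also have "\<dots> = (\<Sum>j\<in>J. b j * e j)" by (rule sum.cong) (auto simp: J_def c_def)
    finally show ?thesis .
  qed
  define F where "F r x = (\<Sum>j\<le>n. c j * exp (\<beta> j * r) * radial_part (X j) x)" for r x
  define G where "G r x = (\<Sum>j\<le>n. c j * exp (\<beta> j * r) * angular_part (X j) x)" for r x
  define F' where "F' r x = (\<Sum>j\<le>n. c j * \<beta> j * exp (\<beta> j * r) * radial_part (X j) x)" for r x
  define G' where "G' r x = (\<Sum>j\<le>n. c j * \<beta> j * exp (\<beta> j * r) * angular_part (X j) x)" for r x
  define Y where "Y \<epsilon> = combined_field n X (\<lambda>j. \<epsilon> * c j)" for \<epsilon>
  have Y_polar: "Y \<epsilon> (pol r x) = (exp r * (\<epsilon> * F r x * cos x - (1 + \<epsilon> * G r x) * sin x),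
      exp r * (\<epsilon> * F r x * sin x + (1 + \<epsilon> * G r x) * cos x))" for \<epsilon> r x
  proof -
    have *: "(\<epsilon> * c j) *\<^sub>R X j (pol r x) = 
       (exp r * \<epsilon> * (c j * exp (\<beta> j * r) * radial_part (X j) x * cos x - c j * exp (\<beta> j * r) * angular_part (X j) x * sin x),
        exp r * \<epsilon> * (c j * exp (\<beta> j * r) * radial_part (X j) x * sin x + c j * exp (\<beta> j * r) * angular_part (X j) x * cos x))"
      if "j \<le> n" for j
    proof -
      have "exp (\<alpha> j * r) = exp r * exp (\<beta> j * r)" by (simp add: \<beta>_def exp_add[symmetric] algebra_simps)
      then show ?thesis by (simp add: homogeneous_polar[OF hom[OF that]] algebra_simps)
    qed
    have "(\<Sum>j\<le>n. (\<epsilon> * c j) *\<^sub>R X j (pol r x)) = 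
       (exp r * \<epsilon> * (F r x * cos x - G r x * sin x), exp r * \<epsilon> * (F r x * sin x + G r x * cos x))"
      by (simp add: * F_def G_def prod_eq_iff fst_sum snd_sum sum_distrib_left[symmetric] sum_distrib_right
          sum_subtractf sum.distrib)
    then show ?thesis
      by (simp add: Y_def combined_field_def pol_def algebra_simps)
  qed
  have Y_cont: "continuous_on UNIV (Y \<epsilon>)" for \<epsilon>
    unfolding Y_def combined_field_def case_prod_beta'
    by (intro continuous_on_add continuous_on_sum continuous_intros) (auto intro: Xc)
  have "\<forall>\<^sub>F \<epsilon> in at_right 0. \<exists>\<gamma>. hyperbolic_limit_cycle (Y \<epsilon>) \<gamma> \<and>
      \<gamma> \<subseteq> {p. exp (z - 1/2) < norm p \<and> norm p < exp (z + 1/2)}" if z: "z \<in> Z" for z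
  proof (rule averaging[where F=F and G=G and F'=F' and G'=G'])
    show "continuous_on UNIV (\<lambda>p. F (fst p) (snd p))" "continuous_on UNIV (\<lambda>p. G (fst p) (snd p))"
      "continuous_on UNIV (\<lambda>p. F' (fst p) (snd p))" "continuous_on UNIV (\<lambda>p. G' (fst p) (snd p))"
      unfolding F_def G_def F'_def G'_def
      by (intro exp_weighted_continuous polar_parts_continuous Xc; assumption)+
    show "((\<lambda>r. F r x) has_real_derivative F' r x) (at r)" "((\<lambda>r. G r x) has_real_derivative G' r x) (at r)" for r x
      unfolding F_def G_def F'_def G'_def by (rule exp_weighted_deriv)+
    show "F r (x + 2*pi) = F r x" "G r (x + 2*pi) = G r x" for r x
      by (simp_all add: F_def G_def radial_part_def angular_part_def)
    have "integral {0..2*pi} (F z) = exp_sum J b \<beta> z"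
      using exp_weighted_integral[where n=n and c=c and \<beta>=\<beta> and r=z and X=X, OF Xc] by (simp add: F_def[abs_def] c_int exp_sum_def)
    then show "integral {0..2*pi} (F z) = 0" using b(2)[OF z] by simp
    have "integral {0..2*pi} (F' z) = (\<Sum>j\<le>n. c j * (\<beta> j * exp (\<beta> j * z)) * radial_integral (X j))"
      unfolding F'_def[abs_def] using exp_weighted_integral[where n=n and c="\<lambda>j. c j * \<beta> j" and \<beta>=\<beta> and r=z and X=X, OF Xc] by (simp add: mult.assoc)
    also have "\<dots> = exp_sum J (\<lambda>j. b j * \<beta> j) \<beta> z"
      unfolding c_int exp_sum_def by (simp add: mult.assoc)
    finally show "integral {0..2*pi} (F' z) \<noteq> 0"
      using exp_sum_simple_zeros[OF J(1) inj b(1) Z(1) _ b(2) z] J Z by simp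
  qed (use Y_polar Y_cont in auto)
  then have "\<forall>\<^sub>F \<epsilon> in at_right 0. \<forall>z\<in>Z. \<exists>\<gamma>. hyperbolic_limit_cycle (Y \<epsilon>) \<gamma> \<and>
      \<gamma> \<subseteq> {p. exp (z - 1/2) < norm p \<and> norm p < exp (z + 1/2)}"
    using Z(1) by (simp add: eventually_ball_finite)
  then obtain \<epsilon> where "\<forall>z\<in>Z. \<exists>\<gamma>. hyperbolic_limit_cycle (Y \<epsilon>) \<gamma> \<and>
      \<gamma> \<subseteq> {p. exp (z - 1/2) < norm p \<and> norm p < exp (z + 1/2)}"
    using eventually_happens trivial_limit_at_right_real by blast
  then obtain \<gamma> where \<gamma>: "\<And>z. z \<in> Z \<Longrightarrow> hyperbolic_limit_cycle (Y \<epsilon>) (\<gamma> z)"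
    "\<And>z. z \<in> Z \<Longrightarrow> \<gamma> z \<subseteq> {p. exp (z - 1/2) < norm p \<and> norm p < exp (z + 1/2)}" by metis
  have "inj_on \<gamma> Z"
  proof (rule linorder_inj_onI)
    fix y z assume yz: "y < z" "y \<in> Z" "z \<in> Z"
    obtain p where p: "p \<in> \<gamma> y"
      using \<gamma>(1)[OF yz(2)] unfolding hyperbolic_limit_cycle_def by blast
    have "y + 1 \<le> z" using yz by (auto simp: Z_def)
    then have "exp (y + 1/2) \<le> exp (z - 1/2)" by simp
    moreover have "norm p < exp (y + 1/2)" using \<gamma>(2)[OF yz(2)] p by blast
    moreover have "exp (z - 1/2) < norm p" if "p \<in> \<gamma> z" using \<gamma>(2)[OF yz(3)] that by blast
    ultimately have "p \<notin> \<gamma> z" using less_trans not_less by blast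
    with p show "\<gamma> y \<noteq> \<gamma> z" by blast
  qed auto
  then have "card (\<gamma> ` Z) = m" using Z by (simp add: card_image)
  then show ?thesis using Z(1) \<gamma>(1) unfolding Y_def by blast
qed

theorem theorem1p1:
  fixes n m :: nat and \<alpha> :: "nat \<Rightarrow> real" and X :: "nat \<Rightarrow> vector_field"
  assumes "0 \<le> \<alpha> 0"
    and "\<And>i j. i < j \<Longrightarrow> j \<le> n \<Longrightarrow> \<alpha> i < \<alpha> j"
    and "\<And>j. j \<le> n \<Longrightarrow> continuous_on UNIV (X j)"
    and "\<And>j. j \<le> n \<Longrightarrow> homogeneous (\<alpha> j) (X j)"
    and "card {j. j \<le> n \<and> radial_integral (X j) \<noteq> 0} = m + 1"
  shows "(\<exists>a :: nat \<Rightarrow> real. \<exists>\<Gamma>. finite \<Gamma> \<and> card \<Gamma> = m \<and>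
            (\<forall>\<gamma>\<in>\<Gamma>. limit_cycle (combined_field n X a) \<gamma>)) \<and>
         ((\<forall>j\<le>n. C1_field (X j)) \<longrightarrow>
          (\<exists>a :: nat \<Rightarrow> real. \<exists>\<Gamma>. finite \<Gamma> \<and> card \<Gamma> = m \<and>
            (\<forall>\<gamma>\<in>\<Gamma>. hyperbolic_limit_cycle (combined_field n X a) \<gamma>)))"
proof -
  obtain a \<Gamma> where "finite \<Gamma>" "card \<Gamma> = m"
    and hyp: "\<forall>\<gamma>\<in>\<Gamma>. hyperbolic_limit_cycle (combined_field n X a) \<gamma>"
    using many_hyperbolic_limit_cycles[OF assms(2-5)] by blast
  moreover have "\<forall>\<gamma>\<in>\<Gamma>. limit_cycle (combined_field n X a) \<gamma>"
    using hyp by (simp add: hyperbolic_limit_cycle_def)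
  ultimately show ?thesis by blast
qed

end
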